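(* Let $S\ne\{0\}$ be a strongly $E^*$-unitary inverse semigroup and $R$ a commutative unital ring. Let $S^\ast=S\cup\{\ast\}$ be the inverse semigroup obtained by adjoining a new identity element $\ast$. Then $S^\ast$ is strongly $E^*$-unitary (a pure grading $\varphi:S^\times\to G$ extends by $\varphi(\ast)=1_G$), the inclusion of idempotent semilattices $E\subseteq E^\ast$ preserves finite covers, and: (1) $L_R(S^\ast)$ is a unital $R$-algebra; (2) there is a natural injective $R$-algebra homomorphism $L_R(S)\hookrightarrow L_R(S^\ast)$, given by $x\delta_g\mapsto x\delta_g$; (3) this inclusion is surjective (so $L_R(S)=L_R(S^\ast)$) if and only if $L_R(S)$ is unital; (4) the image of $L_R(S)$ is an essential ideal of $L_R(S^\ast)$, i.e. it is a two-sided ideal $I$ such that for $x\in L_R(S^\ast)$, $xI=Ix=0$ implies $x=0$.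
   Context: An inverse semigroup with zero $S$ has unique inverses $s^*$; $E$ denotes its idempotents (a meet semilattice with $x\wedge y=xy$, least element $0$), $S^\times=S\setminus\{0\}$, $E^\times=E\setminus\{0\}$. A pure grading is a map $\varphi:S^\times\to G$ to a group with $\varphi(ab)=\varphi(a)\varphi(b)$ whenever $ab\ne0$ and $\varphi^{-1}(1_G)=E^\times$; $S$ is strongly $E^*$-unitary if one exists. For $g\in G$, $E_g=\{x\in E: x\le ss^*$ for some $s$ with $\varphi(s)=g\}$ if $\varphi^{-1}(g)\ne\emptyset$, else $\{0\}$; $\phi_g:E_{g^{-1}}\to E_g$, $x\mapsto sxs^*$ ($\varphi(s)=g$, $x\le s^*s$). For a meet semilattice $P$ with $0$: a filter is a subset $F$, $\emptyset\ne F\ne P$, closed upwards and under meets; $F(P)$ has topology generated by $\{F:x\in F\}$; tight filters $T(P)$ are the closure of the ultrafilters; $V^P_{(x:x_1,\dots,x_n)}=\{\xi\in T(P):x\in\xi, x_i\notin\xi\}$, $V_x=V_{(x:)}$; $\mathcal T_c(P)$ is the generalized Boolean algebra of compact open subsets of $T(P)$. A finite cover of $x\in P$ is a finite set of elements $\le x$ such that every $0\ne y\le x$ meets one of them nontrivially; $P_1\subseteq P_2$ preserves finite covers if every finite cover in $P_1$ of $x\in P_1$ is a finite cover of $x$ in $P_2$. $\mathcal T_c(E_g)$ is identified with the ideal of $\mathcal T_c(E)$ of compact open sets contained in $\bigcup_{x\in E_g}V^E_x$, and $\hat\phi_g:\mathcal T_c(E_{g^{-1}})\to\mathcal T_c(E_g)$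 is the isomorphism induced by $\phi_g$; $\Phi=(\{\mathcal T_c(E_g)\},\{\hat\phi_g\})$ is a partial action of $G$ on $\mathcal T_c(E)$. For a partial action $\Phi=(\{\mathcal I_t\},\{\psi_t\})$ on a generalized Boolean algebra $\mathcal B$: $\mathrm{Lc}(R,\mathcal B)$ is the $R$-algebra of functions $f:R\setminus\{0\}\to\mathcal B$ with pairwise disjoint values, almost all $0$, viewed as $\sum_r r1_{f(r)}$; $\mathrm{Lc}(R,\mathcal B)\rtimes_\Phi G$ consists of finite sums $\sum_t f_t\delta_t$, $f_t\in\mathrm{Lc}(R,\mathcal I_t)$, with $(a\delta_s)(b\delta_t)=\tilde\psi_s(\tilde\psi_{s^{-1}}(a)b)\delta_{st}$, $\tilde\psi_t(f)=\psi_t\circ f$. $L_R(S,\varphi):=\mathrm{Lc}(R,\mathcal T_c(E))\rtimes_\Phi G$; it is independent of the pure grading up to isomorphism and written $L_R(S)$. For $x\in E_g$, $x\delta_g:=1_{V_x}\delta_g$.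
   Formalization: The filter space is given the topology generated by the sets {F : x∈F} together with their complements {F : x∉F}; with the sets {F : x∈F} alone the compact open sets would not form a generalized Boolean algebra. The ring R is nonzero. *)

theory Defs
  imports "HOL-Analysis.Abstract_Topology" "HOL-Library.Function_Algebras" "HOL-Algebra.Group"
begin

definition inv_semigroup0 :: "'a set \<Rightarrow> ('a \<Rightarrow> 'a \<Rightarrow> 'a) \<Rightarrow> 'a \<Rightarrow> bool" where
  "inv_semigroup0 S m z \<longleftrightarrow>
     z \<in> S \<and>
     (\<forall>a\<in>S. \<forall>b\<in>S. m a b \<in> S) \<and>
     (\<forall>a\<in>S. \<forall>b\<in>S. \<forall>c\<in>S. m (m a b) c = m a (m b c)) \<and>
     (\<forall>a\<in>S. m z a = z \<and> m a z = z) \<and>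
     (\<forall>a\<in>S. \<exists>!b. b \<in> S \<and> m (m a b) a = a \<and> m (m b a) b = b)"

definition star :: "'a set \<Rightarrow> ('a \<Rightarrow> 'a \<Rightarrow> 'a) \<Rightarrow> 'a \<Rightarrow> 'a" where
  "star S m a = (THE b. b \<in> S \<and> m (m a b) a = a \<and> m (m b a) b = b)"

definition idem :: "'a set \<Rightarrow> ('a \<Rightarrow> 'a \<Rightarrow> 'a) \<Rightarrow> 'a set" where
  "idem S m = {e \<in> S. m e e = e}"

definition leq :: "('a \<Rightarrow> 'a \<Rightarrow> 'a) \<Rightarrow> 'a \<Rightarrow> 'a \<Rightarrow> bool" where
  "leq m x y \<longleftrightarrow> x = m x y"

definition pure_grading :: "'a set \<Rightarrow> ('a \<Rightarrow> 'a \<Rightarrow> 'a) \<Rightarrow> 'a \<Rightarrow> ('g, 'b) monoid_scheme \<Rightarrow> ('a \<Rightarrow> 'g) \<Rightarrow> bool" where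
  "pure_grading S m z G \<phi> \<longleftrightarrow>
     (\<forall>s\<in>S - {z}. \<phi> s \<in> carrier G) \<and>
     (\<forall>a\<in>S - {z}. \<forall>b\<in>S - {z}. m a b \<noteq> z \<longrightarrow> \<phi> (m a b) = \<phi> a \<otimes>\<^bsub>G\<^esub> \<phi> b) \<and>
     {s \<in> S - {z}. \<phi> s = \<one>\<^bsub>G\<^esub>} = idem S m - {z}"

definition strongly_Estar_unitary :: "'a set \<Rightarrow> ('a \<Rightarrow> 'a \<Rightarrow> 'a) \<Rightarrow> 'a \<Rightarrow> ('g, 'b) monoid_scheme \<Rightarrow> bool" where
  "strongly_Estar_unitary S m z G \<longleftrightarrow> group G \<and> (\<exists>\<phi>. pure_grading S m z G \<phi>)"

definition Sstar :: "'a set \<Rightarrow> 'a option set" where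
  "Sstar S = Some ` S \<union> {None}"

fun mstar :: "('a \<Rightarrow> 'a \<Rightarrow> 'a) \<Rightarrow> 'a option \<Rightarrow> 'a option \<Rightarrow> 'a option" where
  "mstar m None y = y"
| "mstar m (Some x) None = Some x"
| "mstar m (Some x) (Some y) = Some (m x y)"

definition phistar :: "('g, 'b) monoid_scheme \<Rightarrow> ('a \<Rightarrow> 'g) \<Rightarrow> 'a option \<Rightarrow> 'g" where
  "phistar G \<phi> x = (case x of None \<Rightarrow> \<one>\<^bsub>G\<^esub> | Some a \<Rightarrow> \<phi> a)"

text \<open>Meet semilattice E = idempotents of S, meet = m, least element z.\<close>
definition finite_cover :: "'a set \<Rightarrow> ('a \<Rightarrow> 'a \<Rightarrow> 'a) \<Rightarrow> 'a \<Rightarrow> 'a \<Rightarrow> 'a set \<Rightarrow> bool" where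
  "finite_cover E m z x Z \<longleftrightarrow> finite Z \<and> Z \<subseteq> E \<and> (\<forall>y\<in>Z. leq m y x) \<and>
     (\<forall>y\<in>E. y \<noteq> z \<and> leq m y x \<longrightarrow> (\<exists>w\<in>Z. m y w \<noteq> z))"

definition preserves_finite_covers ::
  "'a set \<Rightarrow> ('a \<Rightarrow> 'a \<Rightarrow> 'a) \<Rightarrow> 'a \<Rightarrow> 'b set \<Rightarrow> ('b \<Rightarrow> 'b \<Rightarrow> 'b) \<Rightarrow> 'b \<Rightarrow> ('a \<Rightarrow> 'b) \<Rightarrow> bool" where
  "preserves_finite_covers E1 m1 z1 E2 m2 z2 j \<longleftrightarrow>
     (\<forall>x\<in>E1. \<forall>Z. finite_cover E1 m1 z1 x Z \<longrightarrow> finite_cover E2 m2 z2 (j x) (j ` Z))"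

definition is_filter :: "'a set \<Rightarrow> ('a \<Rightarrow> 'a \<Rightarrow> 'a) \<Rightarrow> 'a set \<Rightarrow> bool" where
  "is_filter E m F \<longleftrightarrow> F \<noteq> {} \<and> F \<subseteq> E \<and> F \<noteq> E \<and>
     (\<forall>x\<in>F. \<forall>y\<in>E. leq m x y \<longrightarrow> y \<in> F) \<and> (\<forall>x\<in>F. \<forall>y\<in>F. m x y \<in> F)"

definition ultrafilters :: "'a set \<Rightarrow> ('a \<Rightarrow> 'a \<Rightarrow> 'a) \<Rightarrow> 'a set set" where
  "ultrafilters E m = {F. is_filter E m F \<and> (\<forall>F'. is_filter E m F' \<and> F \<subseteq> F' \<longrightarrow> F' = F)}"

text \<open>Topology on the filter space: the (patch) topology with subbasic sets
  {F : x in F} and {F : x not in F}, i.e. the restriction of the product topology on {0,1}^E.\<close>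
definition filter_top :: "'a set \<Rightarrow> ('a \<Rightarrow> 'a \<Rightarrow> 'a) \<Rightarrow> 'a set topology" where
  "filter_top E m = topology_generated_by
     ({ {F. is_filter E m F \<and> x \<in> F} | x. x \<in> E } \<union> { {F. is_filter E m F \<and> x \<notin> F} | x. x \<in> E })"

definition tight :: "'a set \<Rightarrow> ('a \<Rightarrow> 'a \<Rightarrow> 'a) \<Rightarrow> 'a set set" where
  "tight E m = (filter_top E m) closure_of (ultrafilters E m)"

definition tight_top :: "'a set \<Rightarrow> ('a \<Rightarrow> 'a \<Rightarrow> 'a) \<Rightarrow> 'a set topology" where
  "tight_top E m = subtopology (filter_top E m) (tight E m)"

definition Tc :: "'a set \<Rightarrow> ('a \<Rightarrow> 'a \<Rightarrow> 'a) \<Rightarrow> 'a set set set" where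
  "Tc E m = {U. openin (tight_top E m) U \<and> compactin (tight_top E m) U}"

definition Vset :: "'a set \<Rightarrow> ('a \<Rightarrow> 'a \<Rightarrow> 'a) \<Rightarrow> 'a \<Rightarrow> 'a set set" where
  "Vset E m x = {\<xi> \<in> tight E m. x \<in> \<xi>}"

definition Eg :: "'a set \<Rightarrow> ('a \<Rightarrow> 'a \<Rightarrow> 'a) \<Rightarrow> 'a \<Rightarrow> ('a \<Rightarrow> 'g) \<Rightarrow> 'g \<Rightarrow> 'a set" where
  "Eg S m z \<phi> g =
     (if \<exists>s\<in>S - {z}. \<phi> s = g
      then {x \<in> idem S m. \<exists>s\<in>S - {z}. \<phi> s = g \<and> leq m x (m s (star S m s))}
      else {z})"

definition phig :: "'a set \<Rightarrow> ('a \<Rightarrow> 'a \<Rightarrow> 'a) \<Rightarrow> 'a \<Rightarrow> ('a \<Rightarrow> 'g) \<Rightarrow> 'g \<Rightarrow> 'a \<Rightarrow> 'a" where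
  "phig S m z \<phi> g x =
     (let s = (SOME s. s \<in> S - {z} \<and> \<phi> s = g \<and> leq m x (m (star S m s) s))
      in m (m s x) (star S m s))"

text \<open>The open set of T(E) corresponding to T(E_g): union of the V_x, x in E_g.\<close>
definition Dg :: "'a set \<Rightarrow> ('a \<Rightarrow> 'a \<Rightarrow> 'a) \<Rightarrow> 'a \<Rightarrow> ('a \<Rightarrow> 'g) \<Rightarrow> 'g \<Rightarrow> 'a set set" where
  "Dg S m z \<phi> g = (\<Union>x\<in>Eg S m z \<phi> g. Vset (idem S m) m x)"

text \<open>The map on tight filters induced by phi_g (under the identification of T(E_g) with Dg):
  xi in Dg(g^-1) goes to the upward closure in E of phi_g(xi \<inter> E_{g^-1}).\<close>
definition theta :: "'a set \<Rightarrow> ('a \<Rightarrow> 'a \<Rightarrow> 'a) \<Rightarrow> 'a \<Rightarrow> ('g, 'b) monoid_scheme \<Rightarrow> ('a \<Rightarrow> 'g) \<Rightarrow> 'g \<Rightarrow> 'a set \<Rightarrow> 'a set" where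
  "theta S m z G \<phi> g \<xi> =
     {y \<in> idem S m. \<exists>x\<in>\<xi> \<inter> Eg S m z \<phi> (inv\<^bsub>G\<^esub> g). leq m (phig S m z \<phi> g x) y}"

text \<open>hat-phi_g on compact open sets U contained in Dg(g^-1).\<close>
definition hatphi :: "'a set \<Rightarrow> ('a \<Rightarrow> 'a \<Rightarrow> 'a) \<Rightarrow> 'a \<Rightarrow> ('g, 'b) monoid_scheme \<Rightarrow> ('a \<Rightarrow> 'g) \<Rightarrow> 'g \<Rightarrow> 'a set set \<Rightarrow> 'a set set" where
  "hatphi S m z G \<phi> g U = theta S m z G \<phi> g ` U"

text \<open>An element sum_r r 1_{f(r)} of Lc(R, I) is represented by the function
  xi |-> r if xi in f(r), 0 otherwise, on tight filters (and 0 elsewhere).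
  lc S m z D h: h is such a function whose level sets f(r) (r nonzero) are compact open
  sets contained in D, almost all empty.\<close>
definition lc :: "'a set \<Rightarrow> ('a \<Rightarrow> 'a \<Rightarrow> 'a) \<Rightarrow> 'a set set \<Rightarrow> ('a set \<Rightarrow> 'r::comm_ring_1) \<Rightarrow> bool" where
  "lc S m D h \<longleftrightarrow>
     (\<forall>\<xi>. \<xi> \<notin> tight (idem S m) m \<longrightarrow> h \<xi> = 0) \<and>
     finite (h ` tight (idem S m) m) \<and>
     (\<forall>r. r \<noteq> 0 \<longrightarrow> {\<xi> \<in> tight (idem S m) m. h \<xi> = r} \<in> Tc (idem S m) m
                   \<and> {\<xi> \<in> tight (idem S m) m. h \<xi> = r} \<subseteq> D)"

text \<open>tilde-psi_g (f) = hat-phi_g o f, in the function representation.\<close>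
definition tpsi :: "'a set \<Rightarrow> ('a \<Rightarrow> 'a \<Rightarrow> 'a) \<Rightarrow> 'a \<Rightarrow> ('g, 'b) monoid_scheme \<Rightarrow> ('a \<Rightarrow> 'g) \<Rightarrow> 'g
                     \<Rightarrow> ('a set \<Rightarrow> 'r::comm_ring_1) \<Rightarrow> ('a set \<Rightarrow> 'r)" where
  "tpsi S m z G \<phi> g h \<eta> =
     (if \<exists>\<xi>\<in>Dg S m z \<phi> (inv\<^bsub>G\<^esub> g). theta S m z G \<phi> g \<xi> = \<eta>
      then h (SOME \<xi>. \<xi> \<in> Dg S m z \<phi> (inv\<^bsub>G\<^esub> g) \<and> theta S m z G \<phi> g \<xi> = \<eta>)
      else 0)"

text \<open>Carrier of L_R(S, phi) = Lc(R, T_c(E)) \<rtimes> G: finitely supported families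
  (a_t)_{t in G}, a_t in Lc(R, T_c(E_t)); the element is sum_t a_t delta_t.\<close>
definition LR_carrier :: "'a set \<Rightarrow> ('a \<Rightarrow> 'a \<Rightarrow> 'a) \<Rightarrow> 'a \<Rightarrow> ('g, 'b) monoid_scheme \<Rightarrow> ('a \<Rightarrow> 'g)
                          \<Rightarrow> ('g \<Rightarrow> 'a set \<Rightarrow> 'r::comm_ring_1) set" where
  "LR_carrier S m z G \<phi> =
     {a. (\<forall>t. t \<notin> carrier G \<longrightarrow> a t = 0) \<and> finite {t. a t \<noteq> 0} \<and>
         (\<forall>t\<in>carrier G. lc S m (Dg S m z \<phi> t) (a t))}"

text \<open>Multiplication: bilinear extension of (a delta_s)(b delta_t) = psi_s(psi_{s^-1}(a) b) delta_{st}.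
  Addition is pointwise (+ on functions) and the R-action is (r \<cdot> a) t xi = r * a t xi.\<close>
definition LR_mult :: "'a set \<Rightarrow> ('a \<Rightarrow> 'a \<Rightarrow> 'a) \<Rightarrow> 'a \<Rightarrow> ('g, 'b) monoid_scheme \<Rightarrow> ('a \<Rightarrow> 'g)
                       \<Rightarrow> ('g \<Rightarrow> 'a set \<Rightarrow> 'r::comm_ring_1) \<Rightarrow> ('g \<Rightarrow> 'a set \<Rightarrow> 'r) \<Rightarrow> ('g \<Rightarrow> 'a set \<Rightarrow> 'r)" where
  "LR_mult S m z G \<phi> a b =
     (\<lambda>u. \<Sum>s\<in>{s. a s \<noteq> 0}. \<Sum>t\<in>{t. b t \<noteq> 0}.
        if s \<otimes>\<^bsub>G\<^esub> t = u
        then tpsi S m z G \<phi> s (tpsi S m z G \<phi> (inv\<^bsub>G\<^esub> s) (a s) * b t)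
        else 0)"

definition LR_smult :: "'r::comm_ring_1 \<Rightarrow> ('g \<Rightarrow> 'x \<Rightarrow> 'r) \<Rightarrow> ('g \<Rightarrow> 'x \<Rightarrow> 'r)" where
  "LR_smult r a = (\<lambda>t \<xi>. r * a t \<xi>)"

definition xdelta :: "'a set \<Rightarrow> ('a \<Rightarrow> 'a \<Rightarrow> 'a) \<Rightarrow> 'g \<Rightarrow> 'a \<Rightarrow> ('g \<Rightarrow> 'a set \<Rightarrow> 'r::comm_ring_1)" where
  "xdelta S m g x = (\<lambda>t. if t = g then (\<lambda>\<xi>. if \<xi> \<in> Vset (idem S m) m x then 1 else 0) else 0)"

definition LR_unital :: "'a set \<Rightarrow> ('a \<Rightarrow> 'a \<Rightarrow> 'a) \<Rightarrow> 'a \<Rightarrow> ('g, 'b) monoid_scheme \<Rightarrow> ('a \<Rightarrow> 'g) \<Rightarrow> 'r::comm_ring_1 itself \<Rightarrow> bool" where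
  "LR_unital S m z G \<phi> _ \<longleftrightarrow>
     (\<exists>u \<in> (LR_carrier S m z G \<phi> :: ('g \<Rightarrow> 'a set \<Rightarrow> 'r) set).
        \<forall>x \<in> LR_carrier S m z G \<phi>. LR_mult S m z G \<phi> u x = x \<and> LR_mult S m z G \<phi> x u = x)"

end

theory Submission
  imports Defs "HOL-Analysis.Function_Topology" "HOL-Analysis.T1_Spaces"
begin

text \<open>
  A filter of \<open>E\<^sup>*\<close> consists of the new top element together with a filter of \<open>E\<close> or with nothing.
  So the tight spectrum of \<open>E\<^sup>*\<close> is that of \<open>E\<close>, with the point \<open>\<infinity>\<close> given by the new top element
  alone added exactly when the tight spectrum of \<open>E\<close> is not compact; it is always compact, and
  \<open>\<infinity>\<close> is never isolated because it is not an ultrafilter. Hence the constant function 1 in degree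
  1 is a unit of \<open>L(S\<^sup>*)\<close>, extension of functions by zero at \<open>\<infinity>\<close> identifies \<open>L(S)\<close> with the
  elements of \<open>L(S\<^sup>*)\<close> vanishing at \<open>\<infinity>\<close>, and these form an ideal because \<open>\<infinity>\<close> lies in the
  domain of the partial action only for the neutral element, which fixes it. An element annihilated
  by all \<open>e\<delta>\<^sub>1\<close>, \<open>e \<in> E\<close>, is supported at \<open>\<infinity>\<close>, so it vanishes. If \<open>u\<close> is a unit of \<open>L(S)\<close>, then
  \<open>1 - u\<close> annihilates the essential ideal \<open>L(S)\<close>, so \<open>u = 1\<close> and the ideal is everything.

  All multiplications are computed from one formula: the partial homeomorphism of degree \<open>g\<close> sends
  \<open>\<xi>\<close> to \<open>{y. s\<^sup>* y s \<in> \<xi>}\<close> for any \<open>s\<close> of degree \<open>g\<close> with \<open>s\<^sup>* s \<in> \<xi>\<close>.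
\<close>

section \<open>Tight filters of a semilattice with zero\<close>

locale semilat0 =
  fixes E :: "'a set" and m :: "'a \<Rightarrow> 'a \<Rightarrow> 'a" and z :: 'a
  assumes z_in: "z \<in> E"
    and meet_closed: "\<lbrakk>x \<in> E; y \<in> E\<rbrakk> \<Longrightarrow> m x y \<in> E"
    and meet_assoc: "\<lbrakk>x \<in> E; y \<in> E; w \<in> E\<rbrakk> \<Longrightarrow> m (m x y) w = m x (m y w)"
    and meet_comm: "\<lbrakk>x \<in> E; y \<in> E\<rbrakk> \<Longrightarrow> m x y = m y x"
    and meet_idem: "x \<in> E \<Longrightarrow> m x x = x"
    and meet_zero: "x \<in> E \<Longrightarrow> m z x = z"
begin

section \<open>Order, meets and filters in a semilattice with zero\<close>

lemma meet_zero_right: "x \<in> E \<Longrightarrow> m x z = z"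
  using meet_comm meet_zero z_in by metis

lemma leq_refl: "x \<in> E \<Longrightarrow> leq m x x"
  by (simp add: leq_def meet_idem)

lemma leq_trans: "\<lbrakk>x \<in> E; y \<in> E; w \<in> E; leq m x y; leq m y w\<rbrakk> \<Longrightarrow> leq m x w"
  unfolding leq_def by (metis meet_assoc)

lemma meet_leq_left: "\<lbrakk>x \<in> E; y \<in> E\<rbrakk> \<Longrightarrow> leq m (m x y) x"
  unfolding leq_def by (metis meet_assoc meet_comm meet_idem)

lemma meet_leq_right: "\<lbrakk>x \<in> E; y \<in> E\<rbrakk> \<Longrightarrow> leq m (m x y) y"
  unfolding leq_def by (metis meet_assoc meet_idem)

lemma meet_greatest: "\<lbrakk>x \<in> E; y \<in> E; w \<in> E; leq m w x; leq m w y\<rbrakk> \<Longrightarrow> leq m w (m x y)"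
  unfolding leq_def by (metis meet_assoc)

lemma leq_zero: "\<lbrakk>x \<in> E; leq m x z\<rbrakk> \<Longrightarrow> x = z"
  unfolding leq_def using meet_zero_right by simp

lemma filter_subset: "is_filter E m F \<Longrightarrow> F \<subseteq> E"
  and filter_nonempty: "is_filter E m F \<Longrightarrow> F \<noteq> {}"
  and filter_meet: "\<lbrakk>is_filter E m F; x \<in> F; y \<in> F\<rbrakk> \<Longrightarrow> m x y \<in> F"
  and filter_up: "\<lbrakk>is_filter E m F; x \<in> F; y \<in> E; leq m x y\<rbrakk> \<Longrightarrow> y \<in> F"
  by (auto simp: is_filter_def)

text \<open>A filter containing the least element \<open>z\<close> would be all of \<open>E\<close>
  by upward closure, and filters are proper.\<close>

lemma filter_zero: "is_filter E m F \<Longrightarrow> z \<notin> F"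
  unfolding is_filter_def leq_def using meet_zero by (metis subset_antisym subsetI)

text \<open>Properness is checked in the form \<open>z \<notin> F\<close>, which implies
  \<open>F \<noteq> E\<close>.\<close>

lemma filterI:
  assumes "F \<subseteq> E" "F \<noteq> {}" "z \<notin> F"
    and "\<And>x y. \<lbrakk>x \<in> F; y \<in> E; leq m x y\<rbrakk> \<Longrightarrow> y \<in> F"
    and "\<And>x y. \<lbrakk>x \<in> F; y \<in> F\<rbrakk> \<Longrightarrow> m x y \<in> F"
  shows "is_filter E m F"
  using assms z_in unfolding is_filter_def by blast

lemma filter_meet_iff:
  "\<lbrakk>is_filter E m F; x \<in> E; y \<in> E\<rbrakk> \<Longrightarrow> m x y \<in> F \<longleftrightarrow> x \<in> F \<and> y \<in> F"
  by (meson filter_meet filter_up meet_closed meet_leq_left meet_leq_right)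

text \<open>Supplies a nonempty filter, which later shows that the empty set does not correspond to
  an ultrafilter of the enlarged semilattice.\<close>

lemma filter_principal:
  assumes "e \<in> E" "e \<noteq> z"
  shows "is_filter E m {y \<in> E. leq m e y}"
proof (rule filterI)
  show "{y \<in> E. leq m e y} \<noteq> {}" using assms leq_refl by auto
  show "z \<notin> {y \<in> E. leq m e y}" using assms leq_zero by auto
  fix x y
  show "y \<in> {y \<in> E. leq m e y}" if "x \<in> {y \<in> E. leq m e y}" "y \<in> E" "leq m x y"
    using that leq_trans[of e x y] assms(1) by simp
  show "m x y \<in> {y \<in> E. leq m e y}" if "x \<in> {y \<in> E. leq m e y}" "y \<in> {y \<in> E. leq m e y}"
    using that meet_greatest[of x y e] meet_closed assms(1) by simp
qed simp

section \<open>A base of the patch topology on filters\<close>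

definition basic :: "'a \<Rightarrow> 'a set \<Rightarrow> 'a set set" where
  "basic x Y = {F. is_filter E m F \<and> x \<in> F \<and> Y \<inter> F = {}}"

text \<open>Finitely many conditions \<open>x \<in> F\<close> merge into one by taking the meet, and
  finitely many conditions \<open>y \<notin> F\<close> are collected in \<open>Y\<close>. A filter
  is nonempty, so an \<open>x\<close> can be supplied even when only negative conditions are
  given.\<close>

lemma openin_filter_top:
  "openin (filter_top E m) U \<longleftrightarrow>
     (\<forall>F\<in>U. is_filter E m F \<and> (\<exists>x\<in>F. \<exists>Y. finite Y \<and> Y \<subseteq> E \<and> Y \<inter> F = {} \<and> basic x Y \<subseteq> U))"
    (is "?L \<longleftrightarrow> ?R")
proof
  assume ?L
  then have "generate_topology_on ({ {F. is_filter E m F \<and> x \<in> F} | x. x \<in> E }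
      \<union> { {F. is_filter E m F \<and> x \<notin> F} | x. x \<in> E }) U"
    by (simp add: filter_top_def openin_topology_generated_by_iff)
  then show ?R
  proof (induction rule: generate_topology_on.induct)
    case (Int a b)
    show ?case
    proof
      fix F assume F: "F \<in> a \<inter> b"
      then obtain x Y x' Y' where *: "is_filter E m F" "x \<in> F" "x' \<in> F" "finite Y" "finite Y'"
          "Y \<subseteq> E" "Y' \<subseteq> E" "Y \<inter> F = {}" "Y' \<inter> F = {}" "basic x Y \<subseteq> a" "basic x' Y' \<subseteq> b"
        using Int.IH by (metis IntD1 IntD2)
      have E: "x \<in> E" "x' \<in> E" using filter_subset[OF *(1)] *(2,3) by auto
      have "basic (m x x') (Y \<union> Y') \<subseteq> basic x Y \<inter> basic x' Y'"
        using E by (auto simp: basic_def filter_meet_iff)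
      then have "basic (m x x') (Y \<union> Y') \<subseteq> a \<inter> b" using * by blast
      moreover have "m x x' \<in> F" "finite (Y \<union> Y')" "Y \<union> Y' \<subseteq> E" "(Y \<union> Y') \<inter> F = {}"
        using * filter_meet by auto
      ultimately show "is_filter E m F \<and> (\<exists>x\<in>F. \<exists>Y. finite Y \<and> Y \<subseteq> E \<and> Y \<inter> F = {} \<and> basic x Y \<subseteq> a \<inter> b)"
        using *(1) by blast
    qed
  next
    case (UN K)
    show ?case
    proof
      fix F assume "F \<in> \<Union>K"
      then obtain k where k: "k \<in> K" "F \<in> k" by blast
      with UN.IH[OF k(1)] show "is_filter E m F \<and> (\<exists>x\<in>F. \<exists>Y. finite Y \<and> Y \<subseteq> E \<and> Y \<inter> F = {} \<and> basic x Y \<subseteq> \<Union>K)"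
        by (meson Sup_upper order_trans)
    qed
  next
    case (Basis s)
    then consider x where "x \<in> E" "s = {F. is_filter E m F \<and> x \<in> F}"
      | x where "x \<in> E" "s = {F. is_filter E m F \<and> x \<notin> F}" by blast
    then show ?case
    proof cases
      case 1
      then show ?thesis by (auto simp: basic_def intro!: bexI[of _ x] exI[of _ "{}"])
    next
      case 2
      show ?thesis
      proof
        fix F assume F: "F \<in> s"
        then obtain y where "y \<in> F" using 2 filter_nonempty by blast
        then show "is_filter E m F \<and> (\<exists>x\<in>F. \<exists>Y. finite Y \<and> Y \<subseteq> E \<and> Y \<inter> F = {} \<and> basic x Y \<subseteq> s)"
          using F 2 by (auto simp: basic_def intro!: bexI[of _ y] exI[of _ "{x}"])
      qed
    qed
  qed simp
next
  assume R: ?R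
  have open_basic: "openin (filter_top E m) (basic x Y)" if "x \<in> E" "finite Y" "Y \<subseteq> E" for x Y
    using that(2,3)
  proof (induction Y rule: finite_induct)
    case empty
    then show ?case using that(1)
      by (auto simp: basic_def filter_top_def openin_topology_generated_by_iff
          intro!: generate_topology_on.Basis)
  next
    case (insert y Y)
    have "basic x (insert y Y) = basic x Y \<inter> {F. is_filter E m F \<and> y \<notin> F}"
      by (auto simp: basic_def)
    moreover have "openin (filter_top E m) {F. is_filter E m F \<and> y \<notin> F}"
      using insert.prems by (auto simp: filter_top_def openin_topology_generated_by_iff
          intro!: generate_topology_on.Basis)
    ultimately show ?case using insert by auto
  qed
  show ?L
  proof (subst openin_subopen, rule ballI)
    fix F assume "F \<in> U"
    from bspec[OF R this] obtain x Y where *: "is_filter E m F" "x \<in> F" "finite Y" "Y \<subseteq> E"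
        "Y \<inter> F = {}" "basic x Y \<subseteq> U"
      by auto
    have "openin (filter_top E m) (basic x Y)"
      using open_basic *(2-4) filter_subset[OF *(1)] by auto
    moreover have "F \<in> basic x Y" using * by (simp add: basic_def)
    ultimately show "\<exists>T. openin (filter_top E m) T \<and> F \<in> T \<and> T \<subseteq> U" using *(6) by blast
  qed
qed

lemma openin_filter_topE:
  assumes "openin (filter_top E m) U" "F \<in> U"
  obtains x Y where "is_filter E m F" "x \<in> F" "finite Y" "Y \<subseteq> E" "Y \<inter> F = {}" "basic x Y \<subseteq> U"
  using bspec[OF assms(1)[unfolded openin_filter_top] assms(2)] by auto

lemma openin_basic:
  "\<lbrakk>finite Y; Y \<subseteq> E\<rbrakk> \<Longrightarrow> openin (filter_top E m) (basic x Y)"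
  unfolding openin_filter_top by (auto simp: basic_def)

lemma topspace_filter_top: "topspace (filter_top E m) = {F. is_filter E m F}"
proof -
  have "openin (filter_top E m) {F. is_filter E m F}"
    unfolding openin_filter_top using filter_nonempty
    by (auto simp: basic_def intro!: exI[of _ "{}"])
  moreover have "topspace (filter_top E m) \<subseteq> {F. is_filter E m F}"
    using openin_topspace[of "filter_top E m"] unfolding openin_filter_top by blast
  ultimately show ?thesis using openin_subset by blast
qed

section \<open>Tight filters and their topology\<close>

text \<open>Closure only has to be tested on the base sets \<open>basic x Y\<close>. This turns
  tightness into a statement about ultrafilters with no topology left in it.\<close>

lemma tight_iff:
  "F \<in> tight E m \<longleftrightarrow> is_filter E m F \<and>
     (\<forall>x\<in>F. \<forall>Y. finite Y \<and> Y \<subseteq> E \<and> Y \<inter> F = {} \<longrightarrow>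
        (\<exists>U\<in>ultrafilters E m. x \<in> U \<and> Y \<inter> U = {}))" (is "_ \<longleftrightarrow> ?R")
proof
  assume F: "F \<in> tight E m"
  then have filt: "is_filter E m F"
    by (simp add: tight_def in_closure_of topspace_filter_top)
  moreover have "\<exists>U\<in>ultrafilters E m. x \<in> U \<and> Y \<inter> U = {}"
    if "x \<in> F" "finite Y" "Y \<subseteq> E" "Y \<inter> F = {}" for x Y
  proof -
    have "F \<in> basic x Y" using that filt by (simp add: basic_def)
    moreover have "openin (filter_top E m) (basic x Y)" using openin_basic that by blast
    ultimately obtain U where "U \<in> ultrafilters E m" "U \<in> basic x Y"
      using F unfolding tight_def in_closure_of by blast
    then show ?thesis by (auto simp: basic_def)
  qed
  ultimately show ?R by blast
next
  assume R: ?R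
  show "F \<in> tight E m"
    unfolding tight_def in_closure_of
  proof (intro conjI allI impI)
    show "F \<in> topspace (filter_top E m)" using R by (simp add: topspace_filter_top)
    fix T assume T: "F \<in> T \<and> openin (filter_top E m) T"
    then obtain x Y where xY: "x \<in> F" "finite Y" "Y \<subseteq> E" "Y \<inter> F = {}" "basic x Y \<subseteq> T"
      using openin_filter_topE by metis
    then obtain U where "U \<in> ultrafilters E m" "x \<in> U" "Y \<inter> U = {}"
      using bspec[OF conjunct2[OF R] xY(1)] by auto
    then show "\<exists>U. U \<in> ultrafilters E m \<and> U \<in> T"
      using xY(5) by (auto simp: basic_def ultrafilters_def)
  qed
qed

lemma tight_filter: "F \<in> tight E m \<Longrightarrow> is_filter E m F"
  by (simp add: tight_iff)

lemma ultrafilter_tight: "F \<in> ultrafilters E m \<Longrightarrow> F \<in> tight E m"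
  unfolding tight_iff by (auto simp: ultrafilters_def)

lemma openin_tight_top:
  "openin (tight_top E m) U \<longleftrightarrow>
     U \<subseteq> tight E m \<and>
     (\<forall>F\<in>U. \<exists>x\<in>F. \<exists>Y. finite Y \<and> Y \<subseteq> E \<and> Y \<inter> F = {} \<and>
        (\<forall>F'\<in>tight E m. x \<in> F' \<and> Y \<inter> F' = {} \<longrightarrow> F' \<in> U))" (is "_ \<longleftrightarrow> ?R")
proof
  assume "openin (tight_top E m) U"
  then obtain T where T: "openin (filter_top E m) T" "U = T \<inter> tight E m"
    by (auto simp: tight_top_def openin_subtopology)
  have "\<exists>x\<in>F. \<exists>Y. finite Y \<and> Y \<subseteq> E \<and> Y \<inter> F = {} \<and>
        (\<forall>F'\<in>tight E m. x \<in> F' \<and> Y \<inter> F' = {} \<longrightarrow> F' \<in> U)" if "F \<in> U" for F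
  proof -
    have "F \<in> T" using T(2) that by simp
    with T(1) obtain x Y where "x \<in> F" "finite Y" "Y \<subseteq> E" "Y \<inter> F = {}" "basic x Y \<subseteq> T"
      by (rule openin_filter_topE)
    moreover from this have "\<forall>F'\<in>tight E m. x \<in> F' \<and> Y \<inter> F' = {} \<longrightarrow> F' \<in> U"
      using T(2) tight_filter by (auto simp: basic_def)
    ultimately show ?thesis by blast
  qed
  then show ?R using T(2) by blast
next
  assume R: ?R
  \<comment> \<open>The union of all base sets whose tight members lie in \<open>U\<close>: it is
    open among all filters and its trace on the tight ones is \<open>U\<close>.\<close>
  let ?T = "\<Union>{basic x Y |x Y. finite Y \<and> Y \<subseteq> E \<and> (\<forall>F'\<in>tight E m. x \<in> F' \<and> Y \<inter> F' = {} \<longrightarrow> F' \<in> U)}"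
  have "openin (filter_top E m) ?T"
    by (rule openin_Union) (use openin_basic in blast)
  moreover have "U = ?T \<inter> tight E m"
  proof
    show "?T \<inter> tight E m \<subseteq> U" by (auto simp: basic_def)
    show "U \<subseteq> ?T \<inter> tight E m"
    proof
      fix F assume F: "F \<in> U"
      from bspec[OF conjunct2[OF R] this] obtain x Y where "x \<in> F" "finite Y" "Y \<subseteq> E" "Y \<inter> F = {}"
          "\<forall>F'\<in>tight E m. x \<in> F' \<and> Y \<inter> F' = {} \<longrightarrow> F' \<in> U" by auto
      moreover have "F \<in> tight E m" using R F by blast
      moreover from calculation have "F \<in> basic x Y" by (simp add: basic_def tight_filter)
      ultimately show "F \<in> ?T \<inter> tight E m" by blast
    qed
  qed
  ultimately show "openin (tight_top E m) U"
    unfolding tight_top_def openin_subtopology by blast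
qed

lemma openin_tight_topE:
  assumes "openin (tight_top E m) U" "F \<in> U"
  obtains x Y where "x \<in> F" "finite Y" "Y \<subseteq> E" "Y \<inter> F = {}"
    "\<And>F'. \<lbrakk>F' \<in> tight E m; x \<in> F'; Y \<inter> F' = {}\<rbrakk> \<Longrightarrow> F' \<in> U"
  using bspec[OF conjunct2[OF assms(1)[unfolded openin_tight_top]] assms(2)] by auto

lemma tightE:
  assumes "F \<in> tight E m" "x \<in> F" "finite Y" "Y \<subseteq> E" "Y \<inter> F = {}"
  obtains U where "U \<in> ultrafilters E m" "x \<in> U" "Y \<inter> U = {}"
  using assms unfolding tight_iff by metis

lemma topspace_tight_top: "topspace (tight_top E m) = tight E m"
  by (auto simp: tight_top_def topspace_filter_top tight_filter)

lemma openin_Vset: "openin (tight_top E m) (Vset E m x)"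
  unfolding openin_tight_top Vset_def by blast

text \<open>Distinct filters differ in some element \<open>x\<close>, and in the patch topology both
  \<open>x \<in> F\<close> and \<open>x \<notin> F\<close> are open conditions.\<close>

lemma Hausdorff_tight_top: "Hausdorff_space (tight_top E m)"
  unfolding Hausdorff_space_def topspace_tight_top
proof (intro allI impI)
  have *: "\<exists>U V. openin (tight_top E m) U \<and> openin (tight_top E m) V \<and> F \<in> U \<and> F' \<in> V \<and> disjnt U V"
    if F: "F \<in> tight E m" and F': "F' \<in> tight E m" and x: "x \<in> F" "x \<notin> F'" for F F' x
  proof (intro exI conjI)
    show "openin (tight_top E m) (Vset E m x)" by (rule openin_Vset)
    show "openin (tight_top E m) {G \<in> tight E m. x \<notin> G}"
      unfolding openin_tight_top
    proof (intro conjI ballI)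
      fix G assume G: "G \<in> {G \<in> tight E m. x \<notin> G}"
      then obtain y where "y \<in> G" using filter_nonempty tight_filter by blast
      moreover have "x \<in> E" using F x(1) filter_subset tight_filter by blast
      ultimately show "\<exists>y\<in>G. \<exists>Y. finite Y \<and> Y \<subseteq> E \<and> Y \<inter> G = {} \<and>
          (\<forall>F'\<in>tight E m. y \<in> F' \<and> Y \<inter> F' = {} \<longrightarrow> F' \<in> {G \<in> tight E m. x \<notin> G})"
        using G by (intro bexI[of _ y] exI[of _ "{x}"]) auto
    qed auto
  qed (use that in \<open>auto simp: Vset_def disjnt_def\<close>)
  fix F F' assume FF: "F \<in> tight E m \<and> F' \<in> tight E m \<and> F \<noteq> F'"
  then consider x where "x \<in> F" "x \<notin> F'" | x where "x \<in> F'" "x \<notin> F" by blast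
  then show "\<exists>U V. openin (tight_top E m) U \<and> openin (tight_top E m) V \<and> F \<in> U \<and> F' \<in> V \<and> disjnt U V"
  proof cases
    case 1
    then show ?thesis using * FF by blast
  next
    case 2
    then obtain U V where "openin (tight_top E m) U" "openin (tight_top E m) V" "F' \<in> U" "F \<in> V" "disjnt U V"
      using *[of F' F x] FF by blast
    then show ?thesis using disjnt_sym by blast
  qed
qed

section \<open>Finite meets and compactness\<close>

lemma foldr_meet_closed: "\<lbrakk>x \<in> E; set bs \<subseteq> E\<rbrakk> \<Longrightarrow> foldr m bs x \<in> E"
  by (induction bs) (auto simp: meet_closed)

lemma foldr_meet_leq: "\<lbrakk>x \<in> E; set bs \<subseteq> E\<rbrakk> \<Longrightarrow> leq m (foldr m bs x) x"
  by (induction bs)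
    (auto simp: leq_refl intro: leq_trans[OF _ _ _ meet_leq_right] meet_closed foldr_meet_closed)

lemma foldr_meet_leq_mem: "\<lbrakk>x \<in> E; set bs \<subseteq> E; b \<in> set bs\<rbrakk> \<Longrightarrow> leq m (foldr m bs x) b"
proof (induction bs)
  case (Cons c bs)
  then have f: "foldr m bs x \<in> E" "c \<in> E" "b \<in> E" by (auto simp: foldr_meet_closed)
  show ?case
  proof (cases "b = c")
    case True
    then show ?thesis using f by (simp add: meet_leq_left)
  next
    case False
    then have "leq m (foldr m bs x) b" using Cons by auto
    then show ?thesis using f meet_closed meet_leq_right leq_trans[of "m c (foldr m bs x)" "foldr m bs x" b] by simp
  qed
qed simp

lemma filter_foldr_meet:
  "\<lbrakk>is_filter E m F; x \<in> F; set bs \<subseteq> F\<rbrakk> \<Longrightarrow> foldr m bs x \<in> F"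
  by (induction bs) (auto intro: filter_meet)

text \<open>Here \<open>foldr m bs x\<close> is the meet of \<open>x\<close> with all members of
  \<open>bs\<close>; a list is used because \<open>m\<close> is commutative and associative only on
  \<open>E\<close>. Concatenating the lists that witness two members of a generated filter gives a
  list witnessing their meet.\<close>

lemma foldr_meet_append_leq:
  assumes "x \<in> E" "set bs \<subseteq> E" "set cs \<subseteq> E"
  shows "leq m (foldr m (bs @ cs) x) (m (foldr m bs x) (foldr m cs x))"
proof -
  have c: "foldr m cs x \<in> E" using assms foldr_meet_closed by auto
  have 1: "leq m (foldr m (bs @ cs) x) (foldr m cs x)"
    using foldr_meet_leq[OF c assms(2)] by simp
  have "leq m (foldr m (bs @ cs) x) (foldr m bs x)"
    using assms(2)
  proof (induction bs)
    case Nil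
    then show ?case using assms foldr_meet_leq by simp
  next
    case (Cons b bs)
    let ?p = "foldr m (bs @ cs) x" and ?q = "foldr m bs x"
    have E: "b \<in> E" "?p \<in> E" "?q \<in> E" using Cons.prems assms foldr_meet_closed by auto
    have "leq m (m b ?p) ?q"
      using Cons E leq_trans[of "m b ?p" ?p ?q] meet_leq_right meet_closed by auto
    then have "leq m (m b ?p) (m b ?q)" using E meet_greatest meet_leq_left meet_closed by auto
    then show ?case by simp
  qed
  then show ?thesis using 1 assms foldr_meet_closed
    by (intro meet_greatest) (auto simp: foldr_meet_closed)
qed

text \<open>By Alexander's subbase theorem it suffices to treat a cover by sets \<open>{F. a \<in> F}\<close>, \<open>a \<in> A\<close>,
  and \<open>{F. b \<notin> F}\<close>, \<open>b \<in> B\<close>. The elements of \<open>B\<close> together with \<open>x\<close> generate a filter (or else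
  finitely many of them meet in zero); it lies in no set of the second kind, so it contains some
  \<open>a \<in> A\<close>, and only finitely many elements of \<open>B\<close> are needed to witness this.\<close>
lemma compactin_filters_containing:
  assumes x: "x \<in> E"
  shows "compactin (filter_top E m) {F. is_filter E m F \<and> x \<in> F}"
proof -
  let ?C = "{F. is_filter E m F \<and> x \<in> F}"
  define P where "P y = {F. is_filter E m F \<and> y \<in> F}" for y
  define N where "N y = {F. is_filter E m F \<and> y \<notin> F}" for y
  define \<B> where "\<B> = P ` E \<union> N ` E"
  \<comment> \<open>The subspace topology on \<open>?C\<close>, generated by the traces of the
    subbasic sets, in the form to which Alexander's theorem applies.\<close>
  define X where "X = topology (arbitrary union_of (finite intersection_of (\<lambda>b. b \<in> \<B>) relative_to ?C))"
  have ft: "filter_top E m = topology_generated_by \<B>"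
    unfolding filter_top_def \<B>_def P_def N_def by (simp add: setcompr_eq_image)
  have openX: "openin X s \<longleftrightarrow> (arbitrary union_of (finite intersection_of (\<lambda>b. b \<in> \<B>) relative_to ?C)) s" for s
    unfolding X_def by (rule topology_inverse'[OF istopology_subbase, THEN fun_cong])
  have topX: "topspace X = ?C" unfolding X_def by (rule topspace_subbase)
  have "compact_space X"
  proof (rule Alexander_subbase_alt)
    show "?C \<subseteq> \<Union>\<B>" using x by (auto simp: \<B>_def P_def)
    show "topology (arbitrary union_of (finite intersection_of (\<lambda>b. b \<in> \<B>) relative_to ?C)) = X"
      by (simp add: X_def)
    fix C assume C: "C \<subseteq> \<B>" "?C \<subseteq> \<Union>C"
    define A where "A = {y \<in> E. P y \<in> C}"
    define B where "B = {y \<in> E. N y \<in> C}"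
    define Fl where "Fl = {y \<in> E. \<exists>bs. set bs \<subseteq> B \<and> leq m (foldr m bs x) y}"
    have BE: "B \<subseteq> E" by (auto simp: B_def)
    show "\<exists>C'. finite C' \<and> C' \<subseteq> C \<and> ?C \<subseteq> \<Union>C'"
    proof (cases "z \<in> Fl")
      case True
      then obtain bs where bs: "set bs \<subseteq> B" "leq m (foldr m bs x) z" by (auto simp: Fl_def)
      then have "foldr m bs x = z" using BE x foldr_meet_closed leq_zero by (meson subset_trans)
      \<comment> \<open>A filter containing \<open>x\<close> and all of \<open>bs\<close> would
        contain their meet, which is \<open>z\<close>.\<close>
      then have "?C \<subseteq> \<Union>(N ` set bs)"
        using filter_foldr_meet filter_zero by (fastforce simp: N_def)
      then show ?thesis using bs by (intro exI[of _ "N ` set bs"]) (auto simp: B_def)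
    next
      case False
      have BFl: "B \<subseteq> Fl"
      proof
        fix b assume b: "b \<in> B"
        then have "leq m (foldr m [b] x) b" using BE x by (intro foldr_meet_leq_mem) auto
        then show "b \<in> Fl" unfolding Fl_def using b BE by (auto intro!: exI[of _ "[b]"])
      qed
      have xFl: "x \<in> Fl" using x leq_refl by (auto simp: Fl_def intro!: exI[of _ "[]"])
      have "is_filter E m Fl"
      proof (rule filterI)
        fix u v assume uv: "u \<in> Fl" "v \<in> Fl"
        then obtain bs cs where *: "set bs \<subseteq> B" "leq m (foldr m bs x) u" "set cs \<subseteq> B" "leq m (foldr m cs x) v"
            "u \<in> E" "v \<in> E"
          by (auto simp: Fl_def)
        let ?p = "foldr m bs x" and ?q = "foldr m cs x" and ?r = "foldr m (bs @ cs) x"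
        have E: "?p \<in> E" "?q \<in> E" "?r \<in> E" using * BE x by (auto intro!: foldr_meet_closed)
        have r: "leq m ?r (m ?p ?q)" using * BE x by (intro foldr_meet_append_leq) auto
        have "leq m (m ?p ?q) u" "leq m (m ?p ?q) v"
          using leq_trans[OF _ E(1) *(5) meet_leq_left[OF E(1,2)] *(2)]
            leq_trans[OF _ E(2) *(6) meet_leq_right[OF E(1,2)] *(4)] meet_closed[OF E(1,2)] by auto
        then have "leq m (m ?p ?q) (m u v)" using E * meet_closed by (intro meet_greatest) auto
        then have "leq m ?r (m u v)" using r E * meet_closed leq_trans[of ?r "m ?p ?q" "m u v"] by auto
        then show "m u v \<in> Fl" unfolding Fl_def using * meet_closed
          by (auto intro!: exI[of _ "bs @ cs"])
      next
        fix u v assume "u \<in> Fl" "v \<in> E" "leq m u v"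
        moreover from this obtain bs where bs: "set bs \<subseteq> B" "leq m (foldr m bs x) u" "u \<in> E"
          by (auto simp: Fl_def)
        moreover have "foldr m bs x \<in> E" using bs BE x foldr_meet_closed by auto
        ultimately show "v \<in> Fl" unfolding Fl_def using leq_trans[of "foldr m bs x" u v] by auto
      qed (use False xFl in \<open>auto simp: Fl_def\<close>)
      then have "Fl \<in> \<Union>C" using C(2) xFl by auto
      then obtain s where s: "s \<in> C" "Fl \<in> s" by blast
      then consider y where "y \<in> A" "s = P y" | y where "y \<in> B" "s = N y"
        using C(1) by (auto simp: \<B>_def A_def B_def)
      then show ?thesis
      proof cases
        case 1
        then have "y \<in> Fl" using s by (simp add: P_def)
        then obtain bs where bs: "set bs \<subseteq> B" "leq m (foldr m bs x) y" "y \<in> E" by (auto simp: Fl_def)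
        \<comment> \<open>Either \<open>F\<close> contains all of \<open>bs\<close>, and then the
          meet puts \<open>y\<close> into \<open>F\<close>, or \<open>F\<close> misses a member of
          \<open>bs\<close>.\<close>
        have "F \<in> \<Union>(insert (P y) (N ` set bs))" if F: "F \<in> ?C" for F
        proof (cases "set bs \<subseteq> F")
          case True
          then have "y \<in> F" using F bs filter_foldr_meet filter_up by blast
          then show ?thesis using F by (simp add: P_def)
        qed (use F in \<open>auto simp: N_def\<close>)
        then show ?thesis using bs 1 by (intro exI[of _ "insert (P y) (N ` set bs)"]) (auto simp: A_def B_def)
      next
        case 2
        then show ?thesis using s(2) BFl by (auto simp: N_def)
      qed
    qed
  qed
  \<comment> \<open>Traces of generated open sets are open in \<open>X\<close>, so a cover in the
    filter topology becomes a cover in \<open>X\<close> and compactness carries over.\<close>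
  have trace: "openin X (?C \<inter> s)" if "openin (filter_top E m) s" for s
  proof -
    have "generate_topology_on \<B> s" using that by (simp add: ft openin_topology_generated_by_iff)
    then show ?thesis
    proof (induction rule: generate_topology_on.induct)
      case (Int a b)
      then have "openin X ((?C \<inter> a) \<inter> (?C \<inter> b))" by blast
      then show ?case by (simp add: Int_ac Int_left_absorb)
    next
      case (UN K)
      then have "openin X (\<Union>k\<in>K. ?C \<inter> k)" by blast
      moreover have "(\<Union>k\<in>K. ?C \<inter> k) = ?C \<inter> \<Union>K" by blast
      ultimately show ?case by simp
    next
      case (Basis s)
      then have "(finite intersection_of (\<lambda>b. b \<in> \<B>)) s"
        by (rule finite_intersection_of_inc)
      then have "(finite intersection_of (\<lambda>b. b \<in> \<B>) relative_to ?C) (?C \<inter> s)"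
        by (rule relative_to_inc)
      then show ?case unfolding openX by (rule arbitrary_union_of_inc)
    qed simp
  qed
  show ?thesis
    unfolding compactin_def topspace_filter_top
  proof (intro conjI allI impI)
    fix \<U> assume U: "(\<forall>U\<in>\<U>. openin (filter_top E m) U) \<and> ?C \<subseteq> \<Union>\<U>"
    have "\<forall>V\<in>(\<inter>) ?C ` \<U>. openin X V" "topspace X \<subseteq> \<Union>((\<inter>) ?C ` \<U>)"
      using U trace topX by auto
    then obtain \<F> where "finite \<F>" "\<F> \<subseteq> (\<inter>) ?C ` \<U>" "topspace X \<subseteq> \<Union>\<F>"
      using \<open>compact_space X\<close> unfolding compact_space_def compactin_def by meson
    then obtain \<G> where \<G>: "\<G> \<subseteq> \<U>" "finite \<G>" "\<F> = (\<inter>) ?C ` \<G>"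
      by (meson finite_subset_image)
    have "?C \<subseteq> \<Union>\<G>" using \<open>topspace X \<subseteq> \<Union>\<F>\<close> unfolding topX \<G>(3) by auto
    then show "\<exists>\<F>. finite \<F> \<and> \<F> \<subseteq> \<U> \<and> ?C \<subseteq> \<Union>\<F>"
      using \<G>(1,2) by (intro exI[of _ \<G>]) simp
  qed auto
qed

text \<open>The tight filters form a closed set, being a closure, so this is the intersection of a
  closed set with a compact one.\<close>

lemma compactin_Vset:
  assumes "x \<in> E"
  shows "compactin (tight_top E m) (Vset E m x)"
proof -
  have "Vset E m x = tight E m \<inter> {F. is_filter E m F \<and> x \<in> F}"
    by (auto simp: Vset_def tight_filter)
  moreover have "closedin (filter_top E m) (tight E m)"
    by (simp add: tight_def)
  ultimately show ?thesis
    unfolding tight_top_def compactin_subtopology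
    using closed_Int_compactin[OF _ compactin_filters_containing[OF assms]] by auto
qed

end

section \<open>Inverse semigroups with zero\<close>

locale inv_sg =
  fixes S :: "'a set" and m :: "'a \<Rightarrow> 'a \<Rightarrow> 'a" (infixl "\<cdot>" 70) and z :: 'a
  assumes inv_sg: "inv_semigroup0 S m z"
begin

abbreviation E :: "'a set" where "E \<equiv> idem S m"
abbreviation T :: "'a set set" where "T \<equiv> tight E m"
abbreviation st :: "'a \<Rightarrow> 'a" where "st \<equiv> star S m"

lemma zS [simp]: "z \<in> S"
  and mS [simp]: "\<lbrakk>a \<in> S; b \<in> S\<rbrakk> \<Longrightarrow> a \<cdot> b \<in> S"
  and assoc: "\<lbrakk>a \<in> S; b \<in> S; c \<in> S\<rbrakk> \<Longrightarrow> a \<cdot> b \<cdot> c = a \<cdot> (b \<cdot> c)"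
  and zl [simp]: "a \<in> S \<Longrightarrow> z \<cdot> a = z"
  and zr [simp]: "a \<in> S \<Longrightarrow> a \<cdot> z = z"
  using inv_sg by (auto simp: inv_semigroup0_def)

lemma star_ex1: "a \<in> S \<Longrightarrow> \<exists>!b. b \<in> S \<and> a \<cdot> b \<cdot> a = a \<and> b \<cdot> a \<cdot> b = b"
  using inv_sg by (auto simp: inv_semigroup0_def)

lemma starS [simp]: "a \<in> S \<Longrightarrow> st a \<in> S"
  and star_inner: "a \<in> S \<Longrightarrow> a \<cdot> st a \<cdot> a = a"
  and star_outer: "a \<in> S \<Longrightarrow> st a \<cdot> a \<cdot> st a = st a"
  using theI'[OF star_ex1] by (auto simp: star_def)

lemma star_unique: "\<lbrakk>a \<in> S; b \<in> S; a \<cdot> b \<cdot> a = a; b \<cdot> a \<cdot> b = b\<rbrakk> \<Longrightarrow> st a = b"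
  unfolding star_def by (rule the1_equality[OF star_ex1]) auto

lemma star_star [simp]: "a \<in> S \<Longrightarrow> st (st a) = a"
  by (rule star_unique) (auto simp: star_inner star_outer)

lemma idemD: "e \<in> E \<Longrightarrow> e \<in> S" "e \<in> E \<Longrightarrow> e \<cdot> e = e"
  by (auto simp: idem_def)

lemma idemI: "\<lbrakk>e \<in> S; e \<cdot> e = e\<rbrakk> \<Longrightarrow> e \<in> E"
  by (auto simp: idem_def)

lemma zE [simp]: "z \<in> E"
  by (simp add: idem_def)

lemma star_idem: "e \<in> E \<Longrightarrow> st e = e"
  by (rule star_unique) (auto simp: idemD)

text \<open>Let \<open>x\<close> be the inverse of \<open>e \<cdot> f\<close>. Then
  \<open>f \<cdot> x \<cdot> e\<close> is also an inverse, so it equals \<open>x\<close>, and this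
  form shows that \<open>x\<close> is idempotent. An idempotent is its own inverse, whence
  \<open>x = e \<cdot> f\<close>.\<close>

lemma idem_mult:
  assumes "e \<in> E" "f \<in> E"
  shows "e \<cdot> f \<in> E"
proof -
  note S = idemD(1)[OF assms(1)] idemD(1)[OF assms(2)]
  define x where "x = st (e \<cdot> f)"
  have x: "x \<in> S" "e \<cdot> (f \<cdot> (x \<cdot> (e \<cdot> f))) = e \<cdot> f" "x \<cdot> (e \<cdot> (f \<cdot> x)) = x"
    using star_inner[of "e \<cdot> f"] star_outer[of "e \<cdot> f"] S by (auto simp: x_def assoc)
  have ee: "e \<cdot> (e \<cdot> y) = e \<cdot> y" "f \<cdot> (f \<cdot> y) = f \<cdot> y" if "y \<in> S" for y
    using that S assms idemD(2) assoc by metis+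
  have x3: "x \<cdot> (e \<cdot> (f \<cdot> (x \<cdot> y))) = x \<cdot> y" if "y \<in> S" for y
    using x that S by (metis assoc mS)
  have "st (e \<cdot> f) = f \<cdot> x \<cdot> e"
    by (rule star_unique) (use S x in \<open>auto simp: assoc ee x3\<close>)
  then have xf: "x = f \<cdot> x \<cdot> e" by (simp add: x_def)
  have "(f \<cdot> x \<cdot> e) \<cdot> (f \<cdot> x \<cdot> e) = f \<cdot> x \<cdot> e"
    using S x by (simp add: assoc x3)
  then have "x \<in> E" using x(1) xf by (metis idemI)
  then have "x = e \<cdot> f" using star_idem[of x] S by (simp add: x_def)
  then show ?thesis using \<open>x \<in> E\<close> by simp
qed

text \<open>Since both products are idempotent, \<open>f \<cdot> e\<close> is an inverse of
  \<open>e \<cdot> f\<close>; but \<open>e \<cdot> f\<close> is its own inverse.\<close>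

lemma idem_commute:
  assumes "e \<in> E" "f \<in> E"
  shows "e \<cdot> f = f \<cdot> e"
proof -
  note S = idemD(1)[OF assms(1)] idemD(1)[OF assms(2)]
  have ee: "e \<cdot> (e \<cdot> y) = e \<cdot> y" "f \<cdot> (f \<cdot> y) = f \<cdot> y" if "y \<in> S" for y
    using that S assms idemD(2) assoc by metis+
  have "e \<cdot> (f \<cdot> (e \<cdot> f)) = e \<cdot> f" "f \<cdot> (e \<cdot> (f \<cdot> e)) = f \<cdot> e"
    using idemD(2)[OF idem_mult[OF assms]] idemD(2)[OF idem_mult[OF assms(2,1)]] S
    by (auto simp: assoc)
  then have "st (e \<cdot> f) = f \<cdot> e"
    by (intro star_unique) (use S in \<open>auto simp: assoc ee\<close>)
  then show ?thesis using star_idem[OF idem_mult[OF assms]] by simp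
qed

sublocale semilat0 E m z
proof
  show "e \<cdot> f = f \<cdot> e" if "e \<in> E" "f \<in> E" for e f using that by (rule idem_commute)
qed (auto simp: idemD idem_mult assoc)

lemma star_idem_right [simp]: "a \<in> S \<Longrightarrow> a \<cdot> st a \<in> E"
  by (rule idemI) (auto simp: assoc[symmetric] star_inner)

lemma star_idem_left [simp]: "a \<in> S \<Longrightarrow> st a \<cdot> a \<in> E"
  by (rule idemI) (auto simp: assoc[symmetric] star_outer)

text \<open>The idempotents \<open>b \<cdot> st b\<close> and \<open>st a \<cdot> a\<close> meet in
  the middle of each product and commute, after which \<open>a\<close> and \<open>b\<close> cancel
  separately.\<close>

lemma star_mult:
  assumes "a \<in> S" "b \<in> S"
  shows "st (a \<cdot> b) = st b \<cdot> st a"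
proof (rule star_unique)
  have c: "(b \<cdot> st b) \<cdot> (st a \<cdot> a) = (st a \<cdot> a) \<cdot> (b \<cdot> st b)"
    using assms by (intro idem_commute) auto
  have "a \<cdot> b \<cdot> (st b \<cdot> st a) \<cdot> (a \<cdot> b) = a \<cdot> ((b \<cdot> st b) \<cdot> (st a \<cdot> a)) \<cdot> b"
    using assms by (simp add: assoc)
  also have "\<dots> = (a \<cdot> st a \<cdot> a) \<cdot> (b \<cdot> st b \<cdot> b)"
    unfolding c using assms by (simp add: assoc)
  finally show "a \<cdot> b \<cdot> (st b \<cdot> st a) \<cdot> (a \<cdot> b) = a \<cdot> b" using assms by (simp add: star_inner)
  have "st b \<cdot> st a \<cdot> (a \<cdot> b) \<cdot> (st b \<cdot> st a) = st b \<cdot> ((st a \<cdot> a) \<cdot> (b \<cdot> st b)) \<cdot> st a"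
    using assms by (simp add: assoc)
  also have "\<dots> = (st b \<cdot> b \<cdot> st b) \<cdot> (st a \<cdot> a \<cdot> st a)"
    unfolding c[symmetric] using assms by (simp add: assoc)
  finally show "st b \<cdot> st a \<cdot> (a \<cdot> b) \<cdot> (st b \<cdot> st a) = st b \<cdot> st a" using assms by (simp add: star_outer)
qed (use assms in auto)

lemma star_eq_zero_iff: "a \<in> S \<Longrightarrow> st a = z \<longleftrightarrow> a = z"
  by (metis star_idem star_star zE)

lemma star_mult_eq_zero_iff: "a \<in> S \<Longrightarrow> a \<cdot> st a = z \<longleftrightarrow> a = z"
  by (metis star_inner zl zr starS)

text \<open>The idempotent \<open>s \<cdot> st s\<close> in the middle moves past \<open>x\<close>
  and is absorbed by \<open>st s\<close>.\<close>

lemma conj_mult: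
  assumes "s \<in> S" "x \<in> E" "y \<in> E"
  shows "(st s \<cdot> x \<cdot> s) \<cdot> (st s \<cdot> y \<cdot> s) = st s \<cdot> (x \<cdot> y) \<cdot> s"
proof -
  have x: "x \<in> S" "y \<in> S" using assms idemD by auto
  have "(st s \<cdot> x \<cdot> s) \<cdot> (st s \<cdot> y \<cdot> s) = st s \<cdot> (x \<cdot> (s \<cdot> st s)) \<cdot> (y \<cdot> s)"
    using x assms by (simp add: assoc)
  also have "x \<cdot> (s \<cdot> st s) = (s \<cdot> st s) \<cdot> x" using assms by (intro idem_commute) auto
  also have "st s \<cdot> (s \<cdot> st s \<cdot> x) \<cdot> (y \<cdot> s) = (st s \<cdot> s \<cdot> st s) \<cdot> (x \<cdot> y) \<cdot> s"
    using x assms by (simp add: assoc)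
  finally show ?thesis using assms by (simp add: star_outer)
qed

lemma conj_idem: "\<lbrakk>s \<in> S; x \<in> E\<rbrakk> \<Longrightarrow> st s \<cdot> x \<cdot> s \<in> E"
  by (rule idemI) (auto simp: conj_mult idemD)

lemma conj_leq: "\<lbrakk>s \<in> S; x \<in> E; y \<in> E; leq m x y\<rbrakk> \<Longrightarrow> leq m (st s \<cdot> x \<cdot> s) (st s \<cdot> y \<cdot> s)"
  unfolding leq_def by (metis conj_mult)

text \<open>Conjugating forth and back leaves only the factor \<open>st s \<cdot> s\<close>. It does
  no harm when testing membership in a filter that contains \<open>st s \<cdot> s\<close>.\<close>

lemma conj_conj:
  assumes "s \<in> S" "x \<in> E"
  shows "st s \<cdot> (s \<cdot> x \<cdot> st s) \<cdot> s = x \<cdot> (st s \<cdot> s)"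
proof -
  have x: "x \<in> S" using assms idemD by auto
  have "st s \<cdot> (s \<cdot> x \<cdot> st s) \<cdot> s = (st s \<cdot> s) \<cdot> x \<cdot> (st s \<cdot> s)"
    using assms x by (simp add: assoc)
  also have "(st s \<cdot> s) \<cdot> x = x \<cdot> (st s \<cdot> s)" using assms by (intro idem_commute) auto
  also have "x \<cdot> (st s \<cdot> s) \<cdot> (st s \<cdot> s) = x \<cdot> (st s \<cdot> s)"
    using assms x idemD(2)[of "st s \<cdot> s"] by (simp only: assoc mS starS star_idem_left)
  finally show ?thesis .
qed

section \<open>Locally constant functions on the tight spectrum\<close>

text \<open>Continuity for the discrete topology on the values, written with basic neighbourhoods so
  that it can be checked by membership alone.\<close>

definition locconst :: "('a set \<Rightarrow> 'r) \<Rightarrow> bool" where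
  "locconst h \<longleftrightarrow> (\<forall>\<xi>\<in>T. \<exists>x\<in>\<xi>. \<exists>Y. finite Y \<and> Y \<subseteq> E \<and> Y \<inter> \<xi> = {} \<and>
     (\<forall>\<eta>\<in>T. x \<in> \<eta> \<and> Y \<inter> \<eta> = {} \<longrightarrow> h \<eta> = h \<xi>))"

lemma locconstE:
  assumes "locconst h" "\<xi> \<in> T"
  obtains x Y where "x \<in> \<xi>" "finite Y" "Y \<subseteq> E" "Y \<inter> \<xi> = {}"
    "\<And>\<eta>. \<lbrakk>\<eta> \<in> T; x \<in> \<eta>; Y \<inter> \<eta> = {}\<rbrakk> \<Longrightarrow> h \<eta> = h \<xi>"
  using bspec[OF assms(1)[unfolded locconst_def] assms(2)] by auto

lemma locconst_openin:
  assumes "locconst h"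
  shows "openin (tight_top E m) {\<xi> \<in> T. P (h \<xi>)}"
  unfolding openin_tight_top
proof (intro conjI ballI)
  fix F assume F: "F \<in> {\<xi> \<in> T. P (h \<xi>)}"
  then have "F \<in> T" by simp
  with assms obtain x Y where *: "x \<in> F" "finite Y" "Y \<subseteq> E" "Y \<inter> F = {}"
    "\<And>\<eta>. \<lbrakk>\<eta> \<in> T; x \<in> \<eta>; Y \<inter> \<eta> = {}\<rbrakk> \<Longrightarrow> h \<eta> = h F"
    by (rule locconstE) blast
  have "F' \<in> {\<xi> \<in> T. P (h \<xi>)}" if "F' \<in> T" "x \<in> F' \<and> Y \<inter> F' = {}" for F'
    using F that(1) *(5)[OF that(1)] that(2) by simp
  with * show "\<exists>x\<in>F. \<exists>Y. finite Y \<and> Y \<subseteq> E \<and> Y \<inter> F = {} \<and>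
      (\<forall>F'\<in>T. x \<in> F' \<and> Y \<inter> F' = {} \<longrightarrow> F' \<in> {\<xi> \<in> T. P (h \<xi>)})" by metis
qed auto

lemma locconst_if_openin:
  assumes "\<And>\<xi>. \<xi> \<in> T \<Longrightarrow> openin (tight_top E m) {\<eta> \<in> T. h \<eta> = h \<xi>}"
  shows "locconst h"
  unfolding locconst_def
proof
  fix \<xi> assume \<xi>: "\<xi> \<in> T"
  then have "\<xi> \<in> {\<eta> \<in> T. h \<eta> = h \<xi>}" by simp
  with assms[OF \<xi>] obtain x Y where *: "x \<in> \<xi>" "finite Y" "Y \<subseteq> E" "Y \<inter> \<xi> = {}"
    "\<And>F'. \<lbrakk>F' \<in> T; x \<in> F'; Y \<inter> F' = {}\<rbrakk> \<Longrightarrow> F' \<in> {\<eta> \<in> T. h \<eta> = h \<xi>}"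
    by (rule openin_tight_topE) blast
  then have "\<forall>\<eta>\<in>T. x \<in> \<eta> \<and> Y \<inter> \<eta> = {} \<longrightarrow> h \<eta> = h \<xi>" by auto
  with * show "\<exists>x\<in>\<xi>. \<exists>Y. finite Y \<and> Y \<subseteq> E \<and> Y \<inter> \<xi> = {} \<and> (\<forall>\<eta>\<in>T. x \<in> \<eta> \<and> Y \<inter> \<eta> = {} \<longrightarrow> h \<eta> = h \<xi>)"
    by metis
qed

text \<open>Every level set of the combined function is a union of intersections of level sets of
  \<open>f\<close> and \<open>h\<close>.\<close>

lemma locconst_combine:
  assumes "locconst f" "locconst h"
  shows "locconst (\<lambda>\<xi>. c (f \<xi>) (h \<xi>))"
proof (rule locconst_if_openin)
  fix \<xi>
  have "openin (tight_top E m) ({\<eta> \<in> T. f \<eta> = u} \<inter> {\<eta> \<in> T. h \<eta> = v})" for u v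
    by (intro openin_Int locconst_openin[OF assms(1)] locconst_openin[OF assms(2)])
  then have "openin (tight_top E m) (\<Union>{{\<eta> \<in> T. f \<eta> = u} \<inter> {\<eta> \<in> T. h \<eta> = v} |u v. c u v = c (f \<xi>) (h \<xi>)})"
    by (intro openin_Union) blast
  moreover have "\<Union>{{\<eta> \<in> T. f \<eta> = u} \<inter> {\<eta> \<in> T. h \<eta> = v} |u v. c u v = c (f \<xi>) (h \<xi>)}
      = {\<eta> \<in> T. c (f \<eta>) (h \<eta>) = c (f \<xi>) (h \<xi>)}"
    by blast
  ultimately show "openin (tight_top E m) {\<eta> \<in> T. c (f \<eta>) (h \<eta>) = c (f \<xi>) (h \<xi>)}" by simp
qed

lemma locconst_const: "locconst (\<lambda>_. c)"
  by (rule locconst_if_openin) (use openin_topspace[of "tight_top E m"] in \<open>simp add: topspace_tight_top\<close>)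

text \<open>The support condition replaces compactness: each \<open>V\<^sub>y\<close> is compact, so a closed subset of a
  finite union of them is compact, and conversely the \<open>V\<^sub>y\<close> cover the whole space.\<close>
definition lc' :: "'a set set \<Rightarrow> ('a set \<Rightarrow> 'r::comm_ring_1) \<Rightarrow> bool" where
  "lc' D h \<longleftrightarrow> (\<forall>\<xi>. h \<xi> \<noteq> 0 \<longrightarrow> \<xi> \<in> T \<and> \<xi> \<in> D) \<and> locconst h \<and>
     (\<exists>Y. finite Y \<and> Y \<subseteq> E \<and> (\<forall>\<xi>. h \<xi> \<noteq> 0 \<longrightarrow> Y \<inter> \<xi> \<noteq> {}))"

text \<open>The support \<open>K\<close> is a finite union of compact sets. As the space is
  Hausdorff, \<open>K\<close> is closed, so the zero level set is open as well; compactness of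
  \<open>K\<close> also extracts the finite set \<open>Y\<close> from the cover by all
  \<open>Vset E m x\<close>.\<close>

lemma lc_imp_lc':
  fixes h :: "'a set \<Rightarrow> 'r::comm_ring_1"
  assumes "lc S m D h"
  shows "lc' D h"
proof -
  let ?L = "\<lambda>r. {\<xi> \<in> T. h \<xi> = r}" and ?X = "tight_top E m"
  have h0: "\<And>\<xi>. \<xi> \<notin> T \<Longrightarrow> h \<xi> = 0" and fin: "finite (h ` T)"
    and op: "\<And>r. r \<noteq> 0 \<Longrightarrow> openin ?X (?L r)" and co: "\<And>r. r \<noteq> 0 \<Longrightarrow> compactin ?X (?L r)"
    and D: "\<And>r. r \<noteq> 0 \<Longrightarrow> ?L r \<subseteq> D"
    using assms by (auto simp: lc_def Tc_def)
  define K where "K = (\<Union>r\<in>h ` T - {0}. ?L r)"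
  have K: "K = {\<xi> \<in> T. h \<xi> \<noteq> 0}" by (auto simp: K_def)
  have cK: "compactin ?X K" unfolding K_def using fin co by (intro compactin_Union) auto
  then have "closedin ?X K" using Hausdorff_tight_top compactin_imp_closedin by blast
  then have "openin ?X (T - K)" by (metis closedin_def topspace_tight_top)
  moreover have "T - K = ?L 0" using K by auto
  ultimately have "openin ?X (?L r)" for r using op by (cases "r = 0") auto
  then have lcst: "locconst h" by (intro locconst_if_openin)
  have "K \<subseteq> \<Union>(Vset E m ` E)"
  proof
    fix \<xi> assume "\<xi> \<in> K"
    then have "\<xi> \<in> T" using K by simp
    moreover from this obtain x where "x \<in> \<xi>" "x \<in> E"
      using tight_filter filter_nonempty filter_subset by blast
    ultimately show "\<xi> \<in> \<Union>(Vset E m ` E)" by (auto simp: Vset_def)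
  qed
  then obtain \<F> where "finite \<F>" "\<F> \<subseteq> Vset E m ` E" "K \<subseteq> \<Union>\<F>"
    using cK openin_Vset unfolding compactin_def by (metis (no_types, lifting) imageE)
  then obtain Y where Y: "finite Y" "Y \<subseteq> E" "K \<subseteq> \<Union>(Vset E m ` Y)"
    by (metis finite_subset_image)
  have "Y \<inter> \<xi> \<noteq> {}" if "h \<xi> \<noteq> 0" for \<xi>
  proof -
    have "\<xi> \<in> K" using that h0 K by auto
    then show ?thesis using Y(3) by (auto simp: Vset_def)
  qed
  moreover have "\<xi> \<in> T \<and> \<xi> \<in> D" if "h \<xi> \<noteq> 0" for \<xi>
    using h0[of \<xi>] D[OF that] that by auto
  ultimately show ?thesis unfolding lc'_def using lcst Y by blast
qed

text \<open>The support lies in the compact set \<open>K\<close>. Level sets are clopen, so the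
  nonzero ones are closed subsets of \<open>K\<close> and hence compact; covering \<open>K\<close>
  by level sets leaves finitely many values.\<close>

lemma lc'_imp_lc:
  fixes h :: "'a set \<Rightarrow> 'r::comm_ring_1"
  assumes "lc' D h"
  shows "lc S m D h"
proof -
  let ?L = "\<lambda>r. {\<xi> \<in> T. h \<xi> = r}" and ?X = "tight_top E m"
  have h0: "\<And>\<xi>. h \<xi> \<noteq> 0 \<Longrightarrow> \<xi> \<in> T \<and> \<xi> \<in> D" and lcst: "locconst h"
    using assms by (auto simp: lc'_def)
  obtain Y where Y: "finite Y" "Y \<subseteq> E" "\<And>\<xi>. h \<xi> \<noteq> 0 \<Longrightarrow> Y \<inter> \<xi> \<noteq> {}"
    using assms by (auto simp: lc'_def)
  define K where "K = (\<Union>y\<in>Y. Vset E m y)"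
  have K: "compactin ?X K" unfolding K_def using Y compactin_Vset by (intro compactin_Union) auto
  have supp: "\<xi> \<in> K" if "h \<xi> \<noteq> 0" for \<xi>
    using that Y(3)[OF that] h0 by (auto simp: K_def Vset_def)
  have cl: "closedin ?X (?L r)" for r
  proof -
    have "openin ?X {\<xi> \<in> T. h \<xi> \<noteq> r}" using locconst_openin[OF lcst] .
    moreover have "T - ?L r = {\<xi> \<in> T. h \<xi> \<noteq> r}" by auto
    ultimately show ?thesis by (simp add: closedin_def topspace_tight_top)
  qed
  have Tc: "?L r \<in> Tc E m" if "r \<noteq> 0" for r
  proof -
    have "?L r \<inter> K = ?L r" using supp that by auto
    then have "compactin ?X (?L r)" using closed_Int_compactin[OF cl K] by metis
    then show ?thesis using locconst_openin[OF lcst] by (simp add: Tc_def)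
  qed
  have "K \<subseteq> \<Union>(?L ` h ` T)" by (auto simp: K_def Vset_def)
  moreover have "\<forall>U\<in>?L ` h ` T. openin ?X U" using locconst_openin[OF lcst] by auto
  ultimately obtain \<F> where \<F>: "finite \<F>" "\<F> \<subseteq> ?L ` h ` T" "K \<subseteq> \<Union>\<F>"
    using K unfolding compactin_def by meson
  from finite_subset_image[OF \<F>(1,2)] obtain R where R: "finite R" "K \<subseteq> \<Union>(?L ` R)"
    using \<F>(3) by auto
  have "h ` T \<subseteq> insert 0 R"
  proof
    fix r assume "r \<in> h ` T"
    then obtain \<xi> where "\<xi> \<in> T" "r = h \<xi>" by blast
    then show "r \<in> insert 0 R" using supp[of \<xi>] R(2) by auto
  qed
  then have "finite (h ` T)" using R(1) finite_subset by auto
  then show ?thesis unfolding lc_def using h0 Tc by auto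
qed

lemma lc_iff: "lc S m D h \<longleftrightarrow> lc' D h"
  using lc_imp_lc' lc'_imp_lc by blast

lemma lc_supp: "lc S m D h \<Longrightarrow> h \<xi> \<noteq> 0 \<Longrightarrow> \<xi> \<in> T \<and> \<xi> \<in> D"
  unfolding lc_iff lc'_def by blast

lemma lc_locconst: "lc S m D h \<Longrightarrow> locconst h"
  unfolding lc_iff lc'_def by blast

lemma lc_finite_cover:
  assumes "lc S m D h"
  obtains Y where "finite Y" "Y \<subseteq> E" "\<And>\<xi>. h \<xi> \<noteq> 0 \<Longrightarrow> Y \<inter> \<xi> \<noteq> {}"
  using assms unfolding lc_iff lc'_def by blast

lemma lcI:
  assumes "\<And>\<xi>. h \<xi> \<noteq> 0 \<Longrightarrow> \<xi> \<in> T \<and> \<xi> \<in> D" "locconst h" "finite Y" "Y \<subseteq> E"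
    "\<And>\<xi>. h \<xi> \<noteq> 0 \<Longrightarrow> Y \<inter> \<xi> \<noteq> {}"
  shows "lc S m D h"
  unfolding lc_iff lc'_def using assms by blast

lemma lc_zero: "lc S m D 0"
  by (rule lcI[where Y = "{}"]) (simp_all add: zero_fun_def locconst_const)

text \<open>Treats sums, differences and scalar multiples at once. The condition
  \<open>c 0 0 = 0\<close> keeps the new support inside the union of the old ones.\<close>

lemma lc_combine:
  assumes f: "lc S m D f" and h: "lc S m D h" and c: "c 0 0 = 0"
  shows "lc S m D (\<lambda>\<xi>. c (f \<xi>) (h \<xi>))"
proof -
  obtain Y where Y: "finite Y" "Y \<subseteq> E" "\<And>\<xi>. f \<xi> \<noteq> 0 \<Longrightarrow> Y \<inter> \<xi> \<noteq> {}"
    using f by (rule lc_finite_cover) blast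
  obtain Y' where Y': "finite Y'" "Y' \<subseteq> E" "\<And>\<xi>. h \<xi> \<noteq> 0 \<Longrightarrow> Y' \<inter> \<xi> \<noteq> {}"
    using h by (rule lc_finite_cover) blast
  have *: "f \<xi> \<noteq> 0 \<or> h \<xi> \<noteq> 0" if "c (f \<xi>) (h \<xi>) \<noteq> 0" for \<xi> using c that by metis
  show ?thesis
  proof (rule lcI[where Y = "Y \<union> Y'"])
    fix \<xi> assume "c (f \<xi>) (h \<xi>) \<noteq> 0"
    from *[OF this] show "\<xi> \<in> T \<and> \<xi> \<in> D" "(Y \<union> Y') \<inter> \<xi> \<noteq> {}"
      using lc_supp[OF f] lc_supp[OF h] Y(3) Y'(3) by blast+
  qed (use Y Y' locconst_combine lc_locconst[OF f] lc_locconst[OF h] in auto)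
qed

lemma lc_add: "\<lbrakk>lc S m D f; lc S m D h\<rbrakk> \<Longrightarrow> lc S m D (f + h)"
  using lc_combine[of D f h "(+)"] by (simp add: plus_fun_def)

lemma lc_diff: "\<lbrakk>lc S m D f; lc S m D h\<rbrakk> \<Longrightarrow> lc S m D (f - h)"
  using lc_combine[of D f h "(-)"] by (simp add: fun_diff_def)

lemma lc_sum:
  "(\<And>i. i \<in> A \<Longrightarrow> lc S m D (f i)) \<Longrightarrow> lc S m D (\<lambda>\<xi>. \<Sum>i\<in>A. f i \<xi>)"
proof (induction A rule: infinite_finite_induct)
  case (insert i A)
  then show ?case using lc_combine[of D "f i" "\<lambda>\<xi>. \<Sum>i\<in>A. f i \<xi>" "(+)"] by simp
qed (use lc_zero in \<open>auto simp: zero_fun_def\<close>)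

section \<open>Transport of filters along elements of the semigroup\<close>

text \<open>The action of \<open>s\<close> on filters: if \<open>s\<^sup>* s \<in> \<xi>\<close> this is the filter generated by
  \<open>s x s\<^sup>*\<close>, \<open>x \<in> \<xi>\<close>.\<close>
definition transport :: "'a \<Rightarrow> 'a set \<Rightarrow> 'a set" where
  "transport s \<xi> = {y \<in> E. st s \<cdot> y \<cdot> s \<in> \<xi>}"

lemma mem_transport_range:
  assumes "s \<in> S" "st s \<cdot> s \<in> \<xi>"
  shows "s \<cdot> st s \<in> transport s \<xi>"
proof -
  have "st s \<cdot> (s \<cdot> st s) \<cdot> s = st s \<cdot> s"
    using assms star_outer[of s] by (simp add: assoc[symmetric])
  then show ?thesis using assms by (simp add: transport_def)
qed

text \<open>Conjugation by \<open>s\<close> preserves order, meets and \<open>z\<close>, so the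
  preimage of a filter is a filter as soon as it is nonempty. The hypothesis
  \<open>st s \<cdot> s \<in> \<xi>\<close> puts \<open>s \<cdot> st s\<close> into it.\<close>

lemma filter_transport:
  assumes s: "s \<in> S" "st s \<cdot> s \<in> \<xi>" and \<xi>: "is_filter E m \<xi>"
  shows "is_filter E m (transport s \<xi>)"
proof (rule filterI)
  show "transport s \<xi> \<noteq> {}" using mem_transport_range s by blast
  show "z \<notin> transport s \<xi>" using s filter_zero[OF \<xi>] by (simp add: transport_def)
  fix x y assume "x \<in> transport s \<xi>"
  then have x: "x \<in> E" "st s \<cdot> x \<cdot> s \<in> \<xi>" by (auto simp: transport_def)
  show "y \<in> transport s \<xi>" if "y \<in> E" "leq m x y"
    using filter_up[OF \<xi> x(2) conj_idem[OF s(1) that(1)] conj_leq[OF s(1) x(1) that]] that(1)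
    by (simp add: transport_def)
  show "x \<cdot> y \<in> transport s \<xi>" if "y \<in> transport s \<xi>"
  proof -
    have y: "y \<in> E" "st s \<cdot> y \<cdot> s \<in> \<xi>" using that by (auto simp: transport_def)
    show ?thesis
      using filter_meet[OF \<xi> x(2) y(2)] conj_mult[OF s(1) x(1) y(1)] idem_mult[OF x(1) y(1)]
      by (simp add: transport_def)
  qed
qed (auto simp: transport_def)

text \<open>By \<open>conj_conj\<close>, membership of \<open>y\<close> in the double transport
  means \<open>y \<cdot> (st s \<cdot> s) \<in> \<xi>\<close>, which is equivalent to
  \<open>y \<in> \<xi>\<close>.\<close>

lemma transport_inverse:
  assumes s: "s \<in> S" "st s \<cdot> s \<in> \<xi>" and \<xi>: "is_filter E m \<xi>"
  shows "transport (st s) (transport s \<xi>) = \<xi>"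
proof -
  have "y \<in> transport (st s) (transport s \<xi>) \<longleftrightarrow> y \<in> \<xi>" if y: "y \<in> E" for y
  proof -
    have "s \<cdot> y \<cdot> st s \<in> E" using conj_idem[of "st s" y] s y by simp
    moreover have "y \<cdot> (st s \<cdot> s) \<in> \<xi> \<longleftrightarrow> y \<in> \<xi>"
      using filter_meet_iff[OF \<xi> y] s by simp
    ultimately show ?thesis using y s conj_conj[OF s(1) y] by (simp add: transport_def)
  qed
  then show ?thesis using filter_subset[OF \<xi>] by (auto simp: transport_def)
qed

lemma transport_mono: "\<xi> \<subseteq> \<eta> \<Longrightarrow> transport s \<xi> \<subseteq> transport s \<eta>"
  by (auto simp: transport_def)

text \<open>A filter above the transported one, transported back along \<open>st s\<close>, contains
  \<open>U\<close> and so equals it; going forward again gives equality upstairs.\<close>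

lemma ultrafilter_transport:
  assumes s: "s \<in> S" "st s \<cdot> s \<in> U" and U: "U \<in> ultrafilters E m"
  shows "transport s U \<in> ultrafilters E m"
proof -
  have fU: "is_filter E m U" using U by (simp add: ultrafilters_def)
  have "F = transport s U" if F: "is_filter E m F" "transport s U \<subseteq> F" for F
  proof -
    have ss: "st (st s) \<cdot> st s \<in> F" using F(2) mem_transport_range[OF s] s(1) by auto
    have "U \<subseteq> transport (st s) F"
      using transport_mono[OF F(2), of "st s"] transport_inverse[OF s fU] by simp
    moreover have "is_filter E m (transport (st s) F)"
      using filter_transport[OF _ ss F(1)] s(1) by simp
    ultimately have "transport (st s) F = U" using U by (auto simp: ultrafilters_def)
    then show ?thesis using transport_inverse[OF _ ss F(1)] s(1) by simp
  qed
  then show ?thesis using filter_transport[OF s fU] by (auto simp: ultrafilters_def)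
qed

text \<open>A basic condition on the image is pulled back to one on \<open>\<xi>\<close>, met there
  by an ultrafilter, and that ultrafilter is transported forward.\<close>

lemma tight_transport:
  assumes s: "s \<in> S" "st s \<cdot> s \<in> \<xi>" and \<xi>: "\<xi> \<in> T"
  shows "transport s \<xi> \<in> T"
  unfolding tight_iff
proof (intro conjI ballI allI impI)
  have f: "is_filter E m \<xi>" using \<xi> by (rule tight_filter)
  show "is_filter E m (transport s \<xi>)" using filter_transport[OF s f] .
  fix x Y assume x: "x \<in> transport s \<xi>" and Y: "finite Y \<and> Y \<subseteq> E \<and> Y \<inter> transport s \<xi> = {}"
  \<comment> \<open>The factor \<open>st s \<cdot> s\<close> forces the ultrafilter found below into
    the domain of \<open>s\<close>.\<close>
  define x' where "x' = (st s \<cdot> x \<cdot> s) \<cdot> (st s \<cdot> s)"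
  define Y' where "Y' = (\<lambda>y. st s \<cdot> y \<cdot> s) ` Y"
  have xE: "x \<in> E" using x by (simp add: transport_def)
  have "x' \<in> \<xi>" using x s filter_meet[OF f] by (simp add: x'_def transport_def)
  moreover have "finite Y'" "Y' \<subseteq> E" "Y' \<inter> \<xi> = {}"
    using Y conj_idem[OF s(1)] by (auto simp: Y'_def transport_def)
  ultimately obtain U where U: "U \<in> ultrafilters E m" "x' \<in> U" "Y' \<inter> U = {}"
    using tightE[OF \<xi>] by metis
  have fU: "is_filter E m U" using U by (simp add: ultrafilters_def)
  have xU: "st s \<cdot> x \<cdot> s \<in> U" "st s \<cdot> s \<in> U"
    using filter_meet_iff[OF fU conj_idem[OF s(1) xE] star_idem_left[OF s(1)]] U(2) by (auto simp: x'_def)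
  show "\<exists>U\<in>ultrafilters E m. x \<in> U \<and> Y \<inter> U = {}"
  proof (intro bexI conjI)
    show "transport s U \<in> ultrafilters E m" using ultrafilter_transport[OF s(1) xU(2) U(1)] .
    show "x \<in> transport s U" using xU xE by (simp add: transport_def)
    show "Y \<inter> transport s U = {}" using U(3) by (auto simp: Y'_def transport_def)
  qed
qed

end

section \<open>Partial actions of pure gradings\<close>

lemma sum_fun_apply: "(\<Sum>i\<in>A. f i) x = (\<Sum>i\<in>A. f i x)"
  by (induction A rule: infinite_finite_induct) auto

locale graded = inv_sg S m z + group G
  for S :: "'a set" and m :: "'a \<Rightarrow> 'a \<Rightarrow> 'a" (infixl "\<cdot>" 70) and z :: 'a
    and G :: "('g, 'b) monoid_scheme" (structure) +
  fixes \<phi> :: "'a \<Rightarrow> 'g"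
  assumes grading: "pure_grading S m z G \<phi>"
begin

abbreviation D :: "'g \<Rightarrow> 'a set set" where "D \<equiv> Dg S m z \<phi>"
abbreviation \<theta> :: "'g \<Rightarrow> 'a set \<Rightarrow> 'a set" where "\<theta> \<equiv> theta S m z G \<phi>"
abbreviation L :: "('g \<Rightarrow> 'a set \<Rightarrow> 'r::comm_ring_1) set" where "L \<equiv> LR_carrier S m z G \<phi>"
abbreviation mult :: "('g \<Rightarrow> 'a set \<Rightarrow> 'r::comm_ring_1) \<Rightarrow> ('g \<Rightarrow> 'a set \<Rightarrow> 'r) \<Rightarrow> ('g \<Rightarrow> 'a set \<Rightarrow> 'r)"
  where "mult \<equiv> LR_mult S m z G \<phi>"

section \<open>Consequences of purity: the degree determines the germ\<close>

lemma phi_carrier [simp]: "\<lbrakk>s \<in> S; s \<noteq> z\<rbrakk> \<Longrightarrow> \<phi> s \<in> carrier G"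
  using grading by (auto simp: pure_grading_def)

lemma phi_mult:
  assumes "a \<in> S" "b \<in> S" "a \<cdot> b \<noteq> z"
  shows "\<phi> (a \<cdot> b) = \<phi> a \<otimes> \<phi> b"
proof -
  have "a \<noteq> z" "b \<noteq> z" using assms by auto
  then show ?thesis using grading assms by (simp add: pure_grading_def)
qed

lemma phi_one_iff: "\<lbrakk>s \<in> S; s \<noteq> z\<rbrakk> \<Longrightarrow> \<phi> s = \<one> \<longleftrightarrow> s \<in> E"
  using grading unfolding pure_grading_def by blast

lemma phi_star:
  assumes "s \<in> S" "s \<noteq> z"
  shows "\<phi> (st s) = inv (\<phi> s)"
proof -
  have nz: "s \<cdot> st s \<noteq> z" using assms star_mult_eq_zero_iff by simp
  then have "\<phi> s \<otimes> \<phi> (st s) = \<one>"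
    using phi_mult[of s "st s"] phi_one_iff[of "s \<cdot> st s"] assms by simp
  then show ?thesis
    using assms star_eq_zero_iff inv_equality[of "\<phi> (st s)" "\<phi> s"] phi_carrier inv_comm by simp
qed

text \<open>The product \<open>s \<cdot> w \<cdot> st t\<close> is nonzero and its degree is
  \<open>\<phi> s \<otimes> \<one> \<otimes> inv (\<phi> t) = \<one>\<close>, so purity makes it
  idempotent.\<close>

lemma phi_conj_idem:
  assumes "s \<in> S" "t \<in> S" "\<phi> s = \<phi> t" "w \<in> E" "w \<noteq> z" "leq m w (st s \<cdot> s)" "leq m w (st t \<cdot> t)"
  shows "s \<cdot> w \<cdot> st t \<in> E" and "s \<cdot> w \<cdot> st t \<cdot> t = s \<cdot> w"
proof -
  have w: "w \<in> S" "w = w \<cdot> (st s \<cdot> s)" "w = w \<cdot> (st t \<cdot> t)"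
    using assms idemD by (auto simp: leq_def)
  show et: "s \<cdot> w \<cdot> st t \<cdot> t = s \<cdot> w" using w assms(1,2) by (metis assoc mS starS)
  have "w = (st s \<cdot> s) \<cdot> w" using w(2) idem_commute[of w "st s \<cdot> s"] assms by simp
  then have "w = st s \<cdot> (s \<cdot> w)" using assms(1) w(1) by (simp add: assoc)
  \<comment> \<open>Multiplying \<open>s \<cdot> w\<close> by \<open>st s\<close> on the left
    recovers \<open>w\<close>, which is nonzero.\<close>
  then have sw: "s \<cdot> w \<noteq> z" using assms(1,5) zr starS by metis
  then have nz: "s \<cdot> w \<cdot> st t \<noteq> z" using et assms(2) zl by metis
  have sz: "s \<noteq> z" "t \<noteq> z" using sw nz w(1) assms(1,2) by (auto simp: star_idem)
  have "\<phi> (s \<cdot> w \<cdot> st t) = \<phi> s \<otimes> \<phi> w \<otimes> \<phi> (st t)"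
    using phi_mult[of "s \<cdot> w" "st t"] phi_mult[of s w] nz sw w(1) assms(1,2) by simp
  also have "\<dots> = \<one>"
    using phi_one_iff[of w] phi_star[of t] assms w(1) sz by simp
  finally show "s \<cdot> w \<cdot> st t \<in> E" using phi_one_iff nz w(1) assms(1,2) by simp
qed

text \<open>The idempotent \<open>e = s \<cdot> w \<cdot> st t\<close> is its own inverse
  \<open>t \<cdot> w \<cdot> st s\<close>. Hence \<open>e \<cdot> t = s \<cdot> w\<close> and
  \<open>e \<cdot> s = t \<cdot> w\<close>, and multiplying the first equation by \<open>e\<close>
  once more compares the two.\<close>

lemma phi_determines_germ:
  assumes "s \<in> S" "t \<in> S" "\<phi> s = \<phi> t" "w \<in> E" "w \<noteq> z" "leq m w (st s \<cdot> s)" "leq m w (st t \<cdot> t)"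
  shows "s \<cdot> w = t \<cdot> w"
proof -
  define e where "e = s \<cdot> w \<cdot> st t"
  have w: "w \<in> S" "w \<cdot> w = w" using assms idemD by auto
  have e: "e \<in> E" "e \<cdot> t = s \<cdot> w" using phi_conj_idem[OF assms] by (auto simp: e_def)
  have "e = st e" using star_idem[OF e(1)] by simp
  also have "\<dots> = t \<cdot> w \<cdot> st s"
    using assms(1,2) w by (simp add: e_def star_mult star_idem[OF assms(4)] assoc)
  finally have es: "e \<cdot> s = t \<cdot> w"
    using phi_conj_idem(2)[of t s w] assms by simp
  have eS: "e \<in> S" "e \<cdot> e = e" using e idemD by auto
  have "s \<cdot> w = e \<cdot> (e \<cdot> t)" using e(2) eS assms(2) by (metis assoc)
  also have "\<dots> = (e \<cdot> s) \<cdot> w" using e(2) eS assms(1) w by (simp add: assoc)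
  also have "\<dots> = t \<cdot> w" using es w assms(2) by (simp add: assoc)
  finally show ?thesis .
qed

text \<open>Makes transport depend on the degree alone. The meet \<open>w\<close> of the two domain
  idempotents lies in \<open>\<xi>\<close>; restricting to \<open>w\<close> makes \<open>s\<close>
  and \<open>t\<close> agree and does not affect membership of the conjugates in
  \<open>\<xi>\<close>.\<close>

lemma conj_mem_filter_iff:
  assumes \<xi>: "is_filter E m \<xi>" and st: "s \<in> S" "t \<in> S" "\<phi> s = \<phi> t" "st s \<cdot> s \<in> \<xi>" "st t \<cdot> t \<in> \<xi>"
    and y: "y \<in> E"
  shows "st s \<cdot> y \<cdot> s \<in> \<xi> \<longleftrightarrow> st t \<cdot> y \<cdot> t \<in> \<xi>"
proof -
  define w where "w = (st s \<cdot> s) \<cdot> (st t \<cdot> t)"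
  have w: "w \<in> \<xi>" using filter_meet[OF \<xi>] st by (simp add: w_def)
  have wE: "w \<in> E" "w \<in> S" using w filter_subset[OF \<xi>] idemD by auto
  have "w \<noteq> z" using w filter_zero[OF \<xi>] by auto
  moreover have "leq m w (st s \<cdot> s)" "leq m w (st t \<cdot> t)"
    unfolding w_def using st by (auto intro: meet_leq_left meet_leq_right)
  ultimately have eq: "s \<cdot> w = t \<cdot> w" by (rule phi_determines_germ[OF st(1-3) wE(1)])
  have *: "st r \<cdot> y \<cdot> r \<in> \<xi> \<longleftrightarrow> st (r \<cdot> w) \<cdot> y \<cdot> (r \<cdot> w) \<in> \<xi>" if r: "r \<in> S" for r
  proof -
    have yS: "y \<in> S" using y idemD by simp
    have c: "st r \<cdot> y \<cdot> r \<in> E" using conj_idem r y by simp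
    have "st (r \<cdot> w) \<cdot> y \<cdot> (r \<cdot> w) = w \<cdot> (st r \<cdot> y \<cdot> r \<cdot> w)"
      using r yS wE by (simp add: star_mult star_idem assoc)
    also have "\<dots> \<in> \<xi> \<longleftrightarrow> st r \<cdot> y \<cdot> r \<in> \<xi>"
      using filter_meet_iff[OF \<xi> wE(1)] filter_meet_iff[OF \<xi> c wE(1)] meet_closed[OF c wE(1)] w by simp
    finally show ?thesis by simp
  qed
  show ?thesis using *[OF st(1)] *[OF st(2)] eq by simp
qed

text \<open>Removes the choice operator: \<open>s \<cdot> x \<cdot> st s\<close> equals
  \<open>(s \<cdot> x) \<cdot> st (s \<cdot> x)\<close>, and \<open>s \<cdot> x\<close> is the same
  for every admissible \<open>s\<close>.\<close>

lemma phig_eq: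
  assumes s: "s \<in> S" "s \<noteq> z" "\<phi> s = g" and x: "x \<in> E" "x \<noteq> z" "leq m x (st s \<cdot> s)"
  shows "phig S m z \<phi> g x = s \<cdot> x \<cdot> st s"
proof -
  define r where "r = (SOME s. s \<in> S - {z} \<and> \<phi> s = g \<and> leq m x (st s \<cdot> s))"
  have r: "r \<in> S" "\<phi> r = g" "leq m x (st r \<cdot> r)"
    using someI[of "\<lambda>s. s \<in> S - {z} \<and> \<phi> s = g \<and> leq m x (st s \<cdot> s)" s] s x by (auto simp: r_def)
  have eq: "r \<cdot> x = s \<cdot> x"
    using r(2) s(3) by (intro phi_determines_germ[OF r(1) s(1) _ x(1,2) r(3) x(3)]) simp
  have xS: "x \<in> S" using x idemD by auto
  have *: "t \<cdot> x \<cdot> st t = (t \<cdot> x) \<cdot> st (t \<cdot> x)" if t: "t \<in> S" for t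
  proof -
    have "(t \<cdot> x) \<cdot> st (t \<cdot> x) = t \<cdot> (x \<cdot> x) \<cdot> st t"
      using t xS star_idem[OF x(1)] by (simp add: star_mult assoc)
    then show ?thesis using idemD(2)[OF x(1)] by simp
  qed
  show ?thesis unfolding phig_def Let_def r_def[symmetric] using *[OF r(1)] *[OF s(1)] eq by simp
qed

text \<open>In the definition of \<open>theta\<close> the semigroup element may vary with
  \<open>x\<close>. By \<open>conj_mem_filter_iff\<close> each of these elements can be exchanged
  for the fixed \<open>s\<close>.\<close>

lemma theta_eq_transport:
  assumes \<xi>: "is_filter E m \<xi>" and s: "s \<in> S" "s \<noteq> z" "\<phi> s = g" "st s \<cdot> s \<in> \<xi>"
  shows "\<theta> g \<xi> = transport s \<xi>"
proof -
  have sz: "st s \<in> S - {z}" using s star_eq_zero_iff by simp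
  have gc: "g \<in> carrier G" using phi_carrier[OF s(1,2)] s(3) by simp
  have phs: "\<phi> (st s) = inv g" using phi_star s by simp
  have Eg: "Eg S m z \<phi> (inv g) = {x \<in> E. \<exists>t\<in>S - {z}. \<phi> t = inv g \<and> leq m x (t \<cdot> st t)}"
    unfolding Eg_def by (rule if_P) (use sz phs in blast)
  have "st s \<cdot> y \<cdot> s \<in> \<xi>" if y: "y \<in> E" and x: "x \<in> \<xi>" "x \<in> Eg S m z \<phi> (inv g)"
    "leq m (phig S m z \<phi> g x) y" for x y
  proof -
    obtain t where t: "t \<in> S" "t \<noteq> z" "\<phi> t = inv g" "leq m x (t \<cdot> st t)" using x(2) Eg by auto
    \<comment> \<open>The set \<open>Eg\<close> for \<open>inv g\<close> provides an element of
      degree \<open>inv g\<close>; its inverse has degree \<open>g\<close> and \<open>x\<close>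
      below its domain idempotent.\<close>
    define r where "r = st t"
    have r: "r \<in> S" "r \<noteq> z" "\<phi> r = g" "leq m x (st r \<cdot> r)"
      using t gc star_eq_zero_iff phi_star[of t] by (auto simp: r_def)
    have xE: "x \<in> E" "x \<in> S" "x \<noteq> z" using x filter_subset[OF \<xi>] filter_zero[OF \<xi>] idemD by auto
    have ph: "phig S m z \<phi> g x = r \<cdot> x \<cdot> st r" using phig_eq r xE by simp
    have rxE: "r \<cdot> x \<cdot> st r \<in> E" using conj_idem[of "st r" x] r xE by simp
    have "leq m (st r \<cdot> (r \<cdot> x \<cdot> st r) \<cdot> r) (st r \<cdot> y \<cdot> r)"
      using conj_leq[OF r(1) rxE y] x(3) ph by simp
    then have "leq m x (st r \<cdot> y \<cdot> r)"
      using conj_conj[OF r(1) xE(1)] r(4) by (simp add: leq_def)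
    then have "st r \<cdot> y \<cdot> r \<in> \<xi>" using filter_up[OF \<xi> x(1)] conj_idem[OF r(1) y] by simp
    moreover have "st r \<cdot> r \<in> \<xi>" using filter_up[OF \<xi> x(1)] r by simp
    ultimately show ?thesis using conj_mem_filter_iff[OF \<xi> r(1) s(1)] r s y by simp
  qed
  moreover have "\<exists>x\<in>\<xi> \<inter> Eg S m z \<phi> (inv g). leq m (phig S m z \<phi> g x) y"
    if y: "y \<in> E" "st s \<cdot> y \<cdot> s \<in> \<xi>" for y
  proof
    \<comment> \<open>The conjugate itself is the witness: \<open>phig\<close> sends it to
      \<open>y \<cdot> (s \<cdot> st s)\<close>, which lies below \<open>y\<close>.\<close>
    let ?x = "st s \<cdot> y \<cdot> s"
    have yS: "y \<in> S" using y idemD by simp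
    have xE: "?x \<in> E" "?x \<noteq> z" using y filter_subset[OF \<xi>] filter_zero[OF \<xi>] by auto
    have le: "leq m ?x (st s \<cdot> s)"
      unfolding leq_def using s(1) yS star_inner[OF s(1)] by (simp add: assoc)
    then show "?x \<in> \<xi> \<inter> Eg S m z \<phi> (inv g)"
      unfolding Eg using y(2) xE sz phs s(1) by (auto intro!: bexI[of _ "st s"])
    have "phig S m z \<phi> g ?x = s \<cdot> ?x \<cdot> st s" using phig_eq[OF s(1-3) xE le] .
    also have "\<dots> = y \<cdot> (s \<cdot> st s)" using conj_conj[of "st s" y] s(1) y(1) by simp
    finally show "leq m (phig S m z \<phi> g ?x) y" using meet_leq_left y(1) s(1) by simp
  qed
  ultimately show ?thesis unfolding theta_def transport_def by blast
qed

section \<open>Domains and partial homeomorphisms\<close>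

text \<open>By upward closure the idempotent \<open>s \<cdot> st s\<close> replaces any element
  below it. If no element has degree \<open>g\<close>, then \<open>Eg\<close> is \<open>{z}\<close>
  and no filter contains \<open>z\<close>.\<close>

lemma Dg_iff: "\<xi> \<in> D g \<longleftrightarrow> \<xi> \<in> T \<and> (\<exists>s\<in>S - {z}. \<phi> s = g \<and> s \<cdot> st s \<in> \<xi>)"
proof (cases "\<exists>s\<in>S - {z}. \<phi> s = g")
  case True
  then have Eg: "Eg S m z \<phi> g = {x \<in> E. \<exists>s\<in>S - {z}. \<phi> s = g \<and> leq m x (s \<cdot> st s)}"
    unfolding Eg_def by simp
  show ?thesis
  proof
    assume "\<xi> \<in> D g"
    then obtain x s where *: "\<xi> \<in> T" "x \<in> \<xi>" "s \<in> S - {z}" "\<phi> s = g" "leq m x (s \<cdot> st s)"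
      unfolding Dg_def Eg Vset_def by blast
    then have "s \<cdot> st s \<in> \<xi>" using filter_up[OF tight_filter] by simp
    then show "\<xi> \<in> T \<and> (\<exists>s\<in>S - {z}. \<phi> s = g \<and> s \<cdot> st s \<in> \<xi>)" using * by blast
  next
    assume "\<xi> \<in> T \<and> (\<exists>s\<in>S - {z}. \<phi> s = g \<and> s \<cdot> st s \<in> \<xi>)"
    then obtain s where *: "\<xi> \<in> T" "s \<in> S - {z}" "\<phi> s = g" "s \<cdot> st s \<in> \<xi>" by blast
    then have "s \<cdot> st s \<in> Eg S m z \<phi> g" unfolding Eg using leq_refl by auto
    then show "\<xi> \<in> D g" unfolding Dg_def by (rule UN_I) (use * in \<open>simp add: Vset_def\<close>)
  qed
next
  case False
  then have "Eg S m z \<phi> g = {z}" by (simp add: Eg_def)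
  then have "D g = {}" using filter_zero[OF tight_filter] by (auto simp: Dg_def Vset_def)
  then show ?thesis using False by blast
qed

lemma Dg_tight: "\<xi> \<in> D g \<Longrightarrow> \<xi> \<in> T"
  by (simp add: Dg_iff)

lemma Dg_invE:
  assumes "g \<in> carrier G" "\<xi> \<in> D (inv g)"
  obtains s where "s \<in> S" "s \<noteq> z" "\<phi> s = g" "st s \<cdot> s \<in> \<xi>"
proof -
  obtain t where t: "t \<in> S" "t \<noteq> z" "\<phi> t = inv g" "t \<cdot> st t \<in> \<xi>"
    using assms(2) unfolding Dg_iff by auto
  show ?thesis
    using that[of "st t"] t assms(1) star_eq_zero_iff phi_star[of t] by simp
qed

text \<open>Every member of a filter is a nonzero idempotent, hence has degree \<open>\<one>\<close>
  and is its own range idempotent.\<close>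

lemma Dg_one: "D \<one> = T"
proof -
  have "\<xi> \<in> D \<one>" if \<xi>: "\<xi> \<in> T" for \<xi>
  proof -
    note f = tight_filter[OF \<xi>]
    obtain x where x: "x \<in> \<xi>" using filter_nonempty[OF f] by blast
    then have xE: "x \<in> E" "x \<noteq> z" using filter_subset[OF f] filter_zero[OF f] by auto
    moreover have "x \<cdot> st x \<in> \<xi>" using x xE by (simp add: star_idem idemD)
    ultimately show ?thesis unfolding Dg_iff using \<xi> phi_one_iff[of x] idemD by auto
  qed
  then show ?thesis using Dg_tight by blast
qed

text \<open>An idempotent \<open>x \<in> \<xi>\<close> can serve as the transporting element, and
  conjugation by \<open>x\<close> is the meet with \<open>x\<close>.\<close>

lemma theta_one:
  assumes \<xi>: "is_filter E m \<xi>"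
  shows "\<theta> \<one> \<xi> = \<xi>"
proof -
  obtain x where x: "x \<in> \<xi>" using filter_nonempty[OF \<xi>] by blast
  then have xE: "x \<in> E" "x \<in> S" "x \<noteq> z" using filter_subset[OF \<xi>] filter_zero[OF \<xi>] idemD by auto
  have "\<theta> \<one> \<xi> = transport x \<xi>"
    by (rule theta_eq_transport[OF \<xi>]) (use xE x phi_one_iff[of x] in \<open>simp_all add: star_idem idemD\<close>)
  also have "\<dots> = \<xi>"
    using filter_meet_iff[OF \<xi>] filter_subset[OF \<xi>] x xE meet_closed
    by (auto simp: transport_def star_idem)
  finally show ?thesis .
qed

lemma theta_Dg:
  assumes g: "g \<in> carrier G" and \<xi>: "\<xi> \<in> D (inv g)"
  shows "\<theta> g \<xi> \<in> D g" and "\<theta> (inv g) (\<theta> g \<xi>) = \<xi>"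
proof -
  obtain s where s: "s \<in> S" "s \<noteq> z" "\<phi> s = g" "st s \<cdot> s \<in> \<xi>" using Dg_invE[OF assms] .
  have \<xi>T: "\<xi> \<in> T" using Dg_tight \<xi> .
  note f = tight_filter[OF \<xi>T]
  have eq: "\<theta> g \<xi> = transport s \<xi>" using theta_eq_transport[OF f s] .
  have r: "s \<cdot> st s \<in> transport s \<xi>" using mem_transport_range s by simp
  show "\<theta> g \<xi> \<in> D g"
    unfolding Dg_iff eq using tight_transport s \<xi>T r by blast
  have "\<theta> (inv g) (transport s \<xi>) = transport (st s) (transport s \<xi>)"
    by (rule theta_eq_transport)
      (use s r star_eq_zero_iff phi_star filter_transport[OF s(1,4) f] in simp_all)
  then show "\<theta> (inv g) (\<theta> g \<xi>) = \<xi>" using eq transport_inverse[OF s(1,4) f] by simp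
qed

lemma theta_inv_Dg:
  assumes "g \<in> carrier G" "\<eta> \<in> D g"
  shows "\<theta> (inv g) \<eta> \<in> D (inv g)" and "\<theta> g (\<theta> (inv g) \<eta>) = \<eta>"
  using theta_Dg[of "inv g" \<eta>] assms by simp_all

text \<open>On its domain \<open>\<theta> g\<close> is injective with inverse
  \<open>\<theta> (inv g)\<close>, so the preimage picked by choice is the only one.\<close>

lemma tpsi_eq:
  assumes g: "g \<in> carrier G"
  shows "tpsi S m z G \<phi> g h \<eta> = (if \<eta> \<in> D g then h (\<theta> (inv g) \<eta>) else 0)"
proof (cases "\<eta> \<in> D g")
  case True
  let ?P = "\<lambda>\<xi>. \<xi> \<in> D (inv g) \<and> \<theta> g \<xi> = \<eta>"
  have ex: "?P (\<theta> (inv g) \<eta>)" using theta_inv_Dg[OF g True] by simp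
  have "?P (SOME \<xi>. ?P \<xi>)" using someI[of ?P, OF ex] .
  then have "(SOME \<xi>. ?P \<xi>) = \<theta> (inv g) \<eta>" using theta_Dg(2)[OF g] by metis
  moreover have "\<exists>\<xi>\<in>D (inv g). \<theta> g \<xi> = \<eta>" using ex by blast
  ultimately show ?thesis using True unfolding tpsi_def by simp
next
  case False
  then have "\<not> (\<exists>\<xi>\<in>D (inv g). \<theta> g \<xi> = \<eta>)" using theta_Dg(1)[OF g] by blast
  then show ?thesis using False unfolding tpsi_def by simp
qed

section \<open>The carrier and the multiplication of the crossed product\<close>

lemma LR_carrierD:
  assumes "a \<in> L"
  shows "a t \<noteq> 0 \<Longrightarrow> t \<in> carrier G" and "finite {t. a t \<noteq> 0}" and "lc S m (D t) (a t)"
proof -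
  show "lc S m (D t) (a t)"
    using assms lc_zero by (cases "t \<in> carrier G") (simp_all add: LR_carrier_def)
qed (use assms in \<open>auto simp: LR_carrier_def\<close>)

lemma LR_carrier_outside: "\<lbrakk>a \<in> L; t \<notin> carrier G\<rbrakk> \<Longrightarrow> a t = 0"
  by (auto simp: LR_carrier_def)

lemma LR_carrier_supp: "\<lbrakk>a \<in> L; a t \<xi> \<noteq> 0\<rbrakk> \<Longrightarrow> \<xi> \<in> D t"
  using lc_supp[OF LR_carrierD(3)] by blast

lemma LR_carrier_add: "\<lbrakk>a \<in> L; b \<in> L\<rbrakk> \<Longrightarrow> a + b \<in> L"
  and LR_carrier_diff: "\<lbrakk>a \<in> L; b \<in> L\<rbrakk> \<Longrightarrow> a - b \<in> L"
proof -
  assume ab: "a \<in> L" "b \<in> L"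
  have fin: "finite ({t. a t \<noteq> 0} \<union> {t. b t \<noteq> 0})" using ab LR_carrierD(2) by blast
  have "finite {t. a t + b t \<noteq> 0}" "finite {t. a t - b t \<noteq> 0}"
    by (rule finite_subset[OF _ fin], auto)+
  then show "a + b \<in> L" "a - b \<in> L"
    using ab by (auto simp: LR_carrier_def intro!: lc_add lc_diff)
qed

lemma LR_carrier_smult:
  assumes a: "a \<in> L"
  shows "LR_smult r a \<in> L"
proof -
  have "finite {t. LR_smult r a t \<noteq> 0}"
    by (rule finite_subset[OF _ LR_carrierD(2)[OF a]])
      (auto simp: LR_smult_def fun_eq_iff dest: mult_not_zero)
  moreover have "lc S m (D t) (LR_smult r a t)" for t
    using lc_combine[OF LR_carrierD(3)[OF a] LR_carrierD(3)[OF a], of "\<lambda>x _. r * x"]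
    by (simp add: LR_smult_def)
  ultimately show ?thesis
    using LR_carrier_outside[OF a] by (simp add: LR_carrier_def LR_smult_def fun_eq_iff)
qed

text \<open>The degree condition leaves only \<open>t = inv s \<otimes> u\<close>, and the two
  applications of \<open>tpsi\<close> cancel on \<open>a s\<close> and move the argument of
  \<open>b\<close>. Any finite \<open>A\<close> containing the support is allowed, so that an index
  can be added or an index set shared.\<close>

lemma LR_mult_apply:
  assumes a: "a \<in> L" and b: "b \<in> L" and u: "u \<in> carrier G"
    and A: "finite A" "{s. a s \<noteq> 0} \<subseteq> A"
  shows "mult a b u \<eta> = (\<Sum>s\<in>A. a s \<eta> * b (inv s \<otimes> u) (\<theta> (inv s) \<eta>))"
proof -
  have inner: "(\<Sum>t\<in>{t. b t \<noteq> 0}.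
      if s \<otimes> t = u then tpsi S m z G \<phi> s (tpsi S m z G \<phi> (inv s) (a s) * b t) else 0) \<eta>
      = a s \<eta> * b (inv s \<otimes> u) (\<theta> (inv s) \<eta>)" (is "?l = ?r") if as: "a s \<noteq> 0" for s
  proof -
    let ?f = "\<lambda>t. tpsi S m z G \<phi> s (tpsi S m z G \<phi> (inv s) (a s) * b t) \<eta>"
    have s: "s \<in> carrier G" using as LR_carrierD(1)[OF a] by blast
    have f: "?f t = a s \<eta> * b t (\<theta> (inv s) \<eta>)" for t
    proof (cases "\<eta> \<in> D s")
      case True
      then show ?thesis using s theta_inv_Dg[OF s True] by (simp add: tpsi_eq)
    next
      case False
      \<comment> \<open>Outside \<open>D s\<close> both sides are zero: \<open>tpsi\<close> by its
        default value, the product because \<open>a s\<close> is supported in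
        \<open>D s\<close>.\<close>
      then have "a s \<eta> = 0" using LR_carrier_supp[OF a] by blast
      then show ?thesis using False s by (simp add: tpsi_eq)
    qed
    have "?l = (\<Sum>t\<in>{t. b t \<noteq> 0}. if s \<otimes> t = u then ?f t else 0)"
      unfolding sum_fun_apply by (rule sum.cong) auto
    also have "\<dots> = (\<Sum>t\<in>{t. b t \<noteq> 0}. if t = inv s \<otimes> u then ?f t else 0)"
    proof (rule sum.cong)
      fix t assume "t \<in> {t. b t \<noteq> 0}"
      then have "t \<in> carrier G" using LR_carrierD(1)[OF b] by blast
      then have "s \<otimes> t = u \<longleftrightarrow> t = inv s \<otimes> u" using s u inv_solve_left by metis
      then show "(if s \<otimes> t = u then ?f t else 0) = (if t = inv s \<otimes> u then ?f t else 0)" by simp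
    qed simp
    also have "\<dots> = (if inv s \<otimes> u \<in> {t. b t \<noteq> 0} then ?f (inv s \<otimes> u) else 0)"
      using LR_carrierD(2)[OF b] by (simp add: sum.delta)
    also have "\<dots> = ?r" unfolding f by auto
    finally show ?thesis .
  qed
  have "mult a b u \<eta> = (\<Sum>s\<in>{s. a s \<noteq> 0}. a s \<eta> * b (inv s \<otimes> u) (\<theta> (inv s) \<eta>))"
    unfolding LR_mult_def sum_fun_apply[of _ "{s. a s \<noteq> 0}"] by (rule sum.cong) (simp_all add: inner)
  also have "\<dots> = (\<Sum>s\<in>A. a s \<eta> * b (inv s \<otimes> u) (\<theta> (inv s) \<eta>))"
    by (rule sum.mono_neutral_left) (use A in auto)
  finally show ?thesis .
qed

lemma LR_mult_support:
  assumes "mult a b u \<noteq> 0"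
  obtains s t where "a s \<noteq> 0" "b t \<noteq> 0" "u = s \<otimes> t"
proof -
  have "mult a b u = 0" if "\<And>s t. \<lbrakk>a s \<noteq> 0; b t \<noteq> 0\<rbrakk> \<Longrightarrow> u \<noteq> s \<otimes> t"
    unfolding LR_mult_def by (intro sum.neutral ballI) (use that in auto)
  then show ?thesis using assms that by blast
qed

lemma LR_mult_outside:
  assumes "a \<in> L" "b \<in> L" "u \<notin> carrier G"
  shows "mult a b u = 0"
  using LR_mult_support[of a b u] LR_carrierD(1)[OF assms(1)] LR_carrierD(1)[OF assms(2)] assms(3)
  by (metis m_closed)

text \<open>For the support, elements \<open>p\<close> of degree \<open>inv s\<close> and
  \<open>q\<close> of degree \<open>inv t\<close> acting in succession show that
  \<open>st (q \<cdot> p)\<close> has degree \<open>s \<otimes> t\<close> and range idempotent in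
  \<open>\<eta>\<close>. Local constancy follows by pulling neighbourhoods back along
  \<open>p\<close>.\<close>

lemma lc_mult_theta:
  assumes s: "s \<in> carrier G" and t: "t \<in> carrier G"
    and f: "lc S m (D s) f" and h: "lc S m (D t) h"
  shows "lc S m (D (s \<otimes> t)) (\<lambda>\<eta>. f \<eta> * h (\<theta> (inv s) \<eta>))"
proof -
  obtain Y where Y: "finite Y" "Y \<subseteq> E" "\<And>\<xi>. f \<xi> \<noteq> 0 \<Longrightarrow> Y \<inter> \<xi> \<noteq> {}"
    using f by (rule lc_finite_cover) blast
  show ?thesis
  proof (rule lcI[OF _ _ Y(1,2)])
    fix \<eta> assume nz: "f \<eta> * h (\<theta> (inv s) \<eta>) \<noteq> 0"
    then have nz: "f \<eta> \<noteq> 0" "h (\<theta> (inv s) \<eta>) \<noteq> 0" by auto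
    show "Y \<inter> \<eta> \<noteq> {}" using Y(3) nz by blast
    have \<eta>: "\<eta> \<in> T" "\<eta> \<in> D (inv (inv s))" using lc_supp[OF f nz(1)] s by auto
    obtain p where p: "p \<in> S" "p \<noteq> z" "\<phi> p = inv s" "st p \<cdot> p \<in> \<eta>"
      using Dg_invE[OF _ \<eta>(2)] s by blast
    have eq: "\<theta> (inv s) \<eta> = transport p \<eta>"
      using theta_eq_transport[OF tight_filter[OF \<eta>(1)] p] .
    then have "transport p \<eta> \<in> D (inv (inv t))" using lc_supp[OF h nz(2)] t by simp
    then obtain q where q: "q \<in> S" "q \<noteq> z" "\<phi> q = inv t" "st q \<cdot> q \<in> transport p \<eta>"
      using Dg_invE[of "inv t" "transport p \<eta>"] t by auto
    have mem: "st (q \<cdot> p) \<cdot> (q \<cdot> p) \<in> \<eta>"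
      using q(4) p(1) q(1) by (simp add: transport_def star_mult assoc)
    then have nzqp: "q \<cdot> p \<noteq> z"
      using filter_zero[OF tight_filter[OF \<eta>(1)]] p(1) q(1) by (metis mS starS zr)
    have "\<phi> (q \<cdot> p) = inv (s \<otimes> t)"
      using phi_mult[OF q(1) p(1) nzqp] p q s t by (simp add: inv_mult_group)
    then have "\<phi> (st (q \<cdot> p)) = s \<otimes> t" using phi_star[OF _ nzqp] p q s t by simp
    then have "\<eta> \<in> D (s \<otimes> t)" unfolding Dg_iff
      using \<eta>(1) mem p q nzqp star_eq_zero_iff[of "q \<cdot> p"] by (intro conjI bexI[of _ "st (q \<cdot> p)"]) auto
    then show "\<eta> \<in> T \<and> \<eta> \<in> D (s \<otimes> t)" using \<eta> by blast
  next
    show "locconst (\<lambda>\<eta>. f \<eta> * h (\<theta> (inv s) \<eta>))"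
      unfolding locconst_def
    proof
      fix \<eta> assume \<eta>: "\<eta> \<in> T"
      obtain x X where x: "x \<in> \<eta>" "finite X" "X \<subseteq> E" "X \<inter> \<eta> = {}"
        "\<And>\<eta>'. \<lbrakk>\<eta>' \<in> T; x \<in> \<eta>'; X \<inter> \<eta>' = {}\<rbrakk> \<Longrightarrow> f \<eta>' = f \<eta>"
        using locconstE[OF lc_locconst[OF f] \<eta>] by metis
      show "\<exists>x\<in>\<eta>. \<exists>Y. finite Y \<and> Y \<subseteq> E \<and> Y \<inter> \<eta> = {} \<and>
          (\<forall>\<eta>'\<in>T. x \<in> \<eta>' \<and> Y \<inter> \<eta>' = {} \<longrightarrow> f \<eta>' * h (\<theta> (inv s) \<eta>') = f \<eta> * h (\<theta> (inv s) \<eta>))"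
      proof (cases "\<eta> \<in> D s")
        case False
        \<comment> \<open>The product vanishes wherever \<open>f\<close> does, so the neighbourhood
          on which \<open>f\<close> is constant suffices.\<close>
        then have "f \<eta> = 0" using lc_supp[OF f] by blast
        then show ?thesis using x
          by (intro bexI[of _ x] exI[of _ X]) auto
      next
        case True
        then have "\<eta> \<in> D (inv (inv s))" using s by simp
        then obtain p where p: "p \<in> S" "p \<noteq> z" "\<phi> p = inv s" "st p \<cdot> p \<in> \<eta>"
          using Dg_invE[of "inv s" \<eta>] s by blast
        have tr: "\<theta> (inv s) \<eta>' = transport p \<eta>'" "transport p \<eta>' \<in> T"
          if "\<eta>' \<in> T" "st p \<cdot> p \<in> \<eta>'" for \<eta>'
          using theta_eq_transport[OF tight_filter[OF that(1)] p(1-3) that(2)]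
            tight_transport[OF p(1) that(2,1)] by auto
        obtain y V where y: "y \<in> transport p \<eta>" "finite V" "V \<subseteq> E" "V \<inter> transport p \<eta> = {}"
          "\<And>\<zeta>. \<lbrakk>\<zeta> \<in> T; y \<in> \<zeta>; V \<inter> \<zeta> = {}\<rbrakk> \<Longrightarrow> h \<zeta> = h (transport p \<eta>)"
          using locconstE[OF lc_locconst[OF h] tr(2)[OF \<eta> p(4)]] by metis
        \<comment> \<open>Together \<open>v\<close> and \<open>W\<close> ensure that
          \<open>f\<close> keeps its value, that \<open>p\<close> acts on the filter, and that the
          transported filter stays where \<open>h\<close> is constant.\<close>
        define v where "v = (st p \<cdot> p) \<cdot> (x \<cdot> (st p \<cdot> y \<cdot> p))"
        define W where "W = X \<union> (\<lambda>y. st p \<cdot> y \<cdot> p) ` V"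
        have yE: "y \<in> E" using y(1) by (simp add: transport_def)
        have xE: "x \<in> E" using x(1) filter_subset[OF tight_filter[OF \<eta>]] by blast
        have cE: "st p \<cdot> y \<cdot> p \<in> E" "st p \<cdot> p \<in> E" using conj_idem[OF p(1) yE] p(1) by auto
        have v: "v \<in> \<zeta> \<longleftrightarrow> st p \<cdot> p \<in> \<zeta> \<and> x \<in> \<zeta> \<and> st p \<cdot> y \<cdot> p \<in> \<zeta>" if "\<zeta> \<in> T" for \<zeta>
          unfolding v_def using filter_meet_iff[OF tight_filter[OF that]] cE xE meet_closed by simp
        show ?thesis
        proof (intro bexI[of _ v] exI[of _ W] conjI ballI impI)
          show "v \<in> \<eta>" using v[OF \<eta>] x p y(1) by (simp add: transport_def)
          show "finite W" "W \<subseteq> E" using x y conj_idem[OF p(1)] by (auto simp: W_def)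
          show "W \<inter> \<eta> = {}" using x y by (auto simp: W_def transport_def)
          fix \<eta>' assume \<eta>': "\<eta>' \<in> T" and vW: "v \<in> \<eta>' \<and> W \<inter> \<eta>' = {}"
          then have in': "st p \<cdot> p \<in> \<eta>'" "x \<in> \<eta>'" "st p \<cdot> y \<cdot> p \<in> \<eta>'" using v[OF \<eta>'] by auto
          have "f \<eta>' = f \<eta>" using x(5)[OF \<eta>' in'(2)] vW by (auto simp: W_def)
          moreover have "h (transport p \<eta>') = h (transport p \<eta>)"
          proof (rule y(5)[OF tr(2)[OF \<eta>' in'(1)]])
            show "y \<in> transport p \<eta>'" using in' yE by (simp add: transport_def)
            show "V \<inter> transport p \<eta>' = {}" using vW by (auto simp: W_def transport_def)
          qed
          ultimately show "f \<eta>' * h (\<theta> (inv s) \<eta>') = f \<eta> * h (\<theta> (inv s) \<eta>)"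
            using tr(1)[OF \<eta>' in'(1)] tr(1)[OF \<eta> p(4)] by simp
        qed
      qed
    qed
  qed
qed

lemma LR_mult_closed:
  assumes a: "a \<in> L" and b: "b \<in> L"
  shows "mult a b \<in> L"
proof -
  have "{u. mult a b u \<noteq> 0} \<subseteq> (\<lambda>(s, t). s \<otimes> t) ` ({s. a s \<noteq> 0} \<times> {t. b t \<noteq> 0})"
    using LR_mult_support by blast
  then have "finite {u. mult a b u \<noteq> 0}"
    using LR_carrierD(2)[OF a] LR_carrierD(2)[OF b] finite_subset by blast
  moreover have "lc S m (D u) (mult a b u)" if u: "u \<in> carrier G" for u
  proof -
    have "mult a b u = (\<lambda>\<eta>. \<Sum>s\<in>{s. a s \<noteq> 0}. a s \<eta> * b (inv s \<otimes> u) (\<theta> (inv s) \<eta>))"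
      using LR_mult_apply[OF a b u LR_carrierD(2)[OF a]] by auto
    moreover have "lc S m (D u) (\<lambda>\<eta>. a s \<eta> * b (inv s \<otimes> u) (\<theta> (inv s) \<eta>))" if "a s \<noteq> 0" for s
    proof -
      have s: "s \<in> carrier G" using that LR_carrierD(1)[OF a] by blast
      then have "s \<otimes> (inv s \<otimes> u) = u" using u by (simp add: m_assoc[symmetric])
      then show ?thesis
        using lc_mult_theta[OF s _ LR_carrierD(3)[OF a] LR_carrierD(3)[OF b], of "inv s \<otimes> u"] s u by simp
    qed
    ultimately show ?thesis using lc_sum[of "{s. a s \<noteq> 0}" "D u" "\<lambda>s \<eta>. a s \<eta> * b (inv s \<otimes> u) (\<theta> (inv s) \<eta>)"]
      by simp
  qed
  ultimately show ?thesis using LR_mult_outside[OF a b] by (simp add: LR_carrier_def)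
qed

lemma LR_mult_diff_right:
  assumes a: "a \<in> L" and b: "b \<in> L" and c: "c \<in> L"
  shows "mult c (a - b) = mult c a - mult c b"
proof (intro ext)
  fix u \<eta>
  show "mult c (a - b) u \<eta> = (mult c a - mult c b) u \<eta>"
  proof (cases "u \<in> carrier G")
    case True
    show ?thesis
      using LR_mult_apply[OF c LR_carrier_diff[OF a b] True LR_carrierD(2)[OF c] subset_refl]
        LR_mult_apply[OF c a True LR_carrierD(2)[OF c] subset_refl]
        LR_mult_apply[OF c b True LR_carrierD(2)[OF c] subset_refl]
      by (simp add: sum_subtractf right_diff_distrib)
  qed (simp add: LR_mult_outside LR_carrier_diff a b c)
qed

section \<open>Multiplication by the elements of degree one\<close>

text \<open>Containing \<open>x\<close> is a clopen condition, and in degree \<open>\<one>\<close>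
  the domain is the whole tight spectrum.\<close>

lemma xdelta_one_carrier:
  assumes "x \<in> E"
  shows "xdelta S m \<one> x \<in> L"
proof -
  have "finite {t. xdelta S m \<one> x t \<noteq> 0}"
    by (rule finite_subset[of _ "{\<one>}"]) (auto simp: xdelta_def)
  moreover have "lc S m (D \<one>) (\<lambda>\<xi>. if \<xi> \<in> Vset E m x then 1 else 0)"
  proof (rule lcI[where Y = "{x}"])
    show "locconst (\<lambda>\<xi>. if \<xi> \<in> Vset E m x then 1 else 0)"
      unfolding locconst_def
    proof
      fix \<xi> assume \<xi>: "\<xi> \<in> T"
      obtain y where y: "y \<in> \<xi>" using filter_nonempty[OF tight_filter[OF \<xi>]] by blast
      show "\<exists>y\<in>\<xi>. \<exists>Y. finite Y \<and> Y \<subseteq> E \<and> Y \<inter> \<xi> = {} \<and> (\<forall>\<eta>\<in>T. y \<in> \<eta> \<and> Y \<inter> \<eta> = {} \<longrightarrow>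
          (if \<eta> \<in> Vset E m x then 1 else 0) = (if \<xi> \<in> Vset E m x then 1 else 0))"
      proof (cases "x \<in> \<xi>")
        case True
        then show ?thesis using \<xi>
          by (intro bexI[of _ x] exI[of _ "{}"]) (auto simp: Vset_def)
      next
        case False
        then show ?thesis using \<xi> y assms
          by (intro bexI[of _ y] exI[of _ "{x}"]) (auto simp: Vset_def)
      qed
    qed
  qed (use assms in \<open>auto simp: Vset_def Dg_one split: if_splits\<close>)
  ultimately show ?thesis
    using lc_zero by (auto simp: LR_carrier_def xdelta_def)
qed

lemma xdelta_mult:
  assumes x: "x \<in> E" and a: "a \<in> L"
  shows "mult (xdelta S m \<one> x) a = (\<lambda>t \<xi>. if x \<in> \<xi> then a t \<xi> else 0)"
proof (intro ext)
  fix u \<eta>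
  note e = xdelta_one_carrier[OF x]
  show "mult (xdelta S m \<one> x) a u \<eta> = (if x \<in> \<eta> then a u \<eta> else 0)"
  proof (cases "u \<in> carrier G")
    case True
    have "{s. xdelta S m \<one> x s \<noteq> 0} \<subseteq> {\<one>}" by (auto simp: xdelta_def)
    then have *: "mult (xdelta S m \<one> x) a u \<eta> = xdelta S m \<one> x \<one> \<eta> * a u (\<theta> \<one> \<eta>)"
      using LR_mult_apply[OF e a True, of "{\<one>}"] True by simp
    show ?thesis
    proof (cases "\<eta> \<in> T")
      case True
      then show ?thesis using * theta_one[OF tight_filter[OF True]]
        by (simp add: xdelta_def Vset_def)
    next
      case False
      then have "a u \<eta> = 0" using LR_carrier_supp[OF a] Dg_tight by blast
      then show ?thesis using * False by (simp add: xdelta_def Vset_def)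
    qed
  next
    case False
    then show ?thesis using LR_mult_outside[OF e a False] LR_carrier_outside[OF a False] by simp
  qed
qed

text \<open>A greatest element lies in every tight filter, so the second factor is the constant 1 in
  degree \<open>\<one>\<close> and only \<open>s = u\<close> survives.\<close>

lemma mult_xdelta_top:
  assumes x: "x \<in> E" and top: "\<And>y. y \<in> E \<Longrightarrow> leq m y x" and a: "a \<in> L"
  shows "mult a (xdelta S m \<one> x) = a"
proof (intro ext)
  fix u \<eta>
  note e = xdelta_one_carrier[OF x]
  have xT: "x \<in> \<xi>" if "\<xi> \<in> T" for \<xi>
  proof -
    note f = tight_filter[OF that]
    obtain y where y: "y \<in> \<xi>" using filter_nonempty[OF f] by blast
    then show ?thesis using filter_up[OF f y x] top filter_subset[OF f] by blast
  qed
  show "mult a (xdelta S m \<one> x) u \<eta> = a u \<eta>"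
  proof (cases "u \<in> carrier G")
    case True
    \<comment> \<open>Adding \<open>u\<close> lets the sum collapse to the index \<open>u\<close>
      even if \<open>a u\<close> is zero.\<close>
    let ?A = "insert u {s. a s \<noteq> 0}"
    have "mult a (xdelta S m \<one> x) u \<eta>
        = (\<Sum>s\<in>?A. a s \<eta> * xdelta S m \<one> x (inv s \<otimes> u) (\<theta> (inv s) \<eta>))"
      using LR_carrierD(2)[OF a] by (intro LR_mult_apply[OF a e True]) auto
    also have "\<dots> = (\<Sum>s\<in>?A. if s = u then a u \<eta> else 0)"
    proof (rule sum.cong)
      fix s assume "s \<in> ?A"
      then have s: "s \<in> carrier G" using True LR_carrierD(1)[OF a] by blast
      have "inv s \<otimes> u = \<one> \<longleftrightarrow> s = u"
        using s True by (metis inv_closed inv_equality inv_inv l_inv)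
      moreover have "\<theta> (inv u) \<eta> \<in> Vset E m x" if "a u \<eta> \<noteq> 0"
        using xT Dg_tight[OF theta_inv_Dg(1)[OF True LR_carrier_supp[OF a that]]] by (simp add: Vset_def)
      ultimately show "a s \<eta> * xdelta S m \<one> x (inv s \<otimes> u) (\<theta> (inv s) \<eta>) = (if s = u then a u \<eta> else 0)"
        using True by (auto simp: xdelta_def)
    qed simp
    also have "\<dots> = a u \<eta>" using LR_carrierD(2)[OF a] by (simp add: sum.delta)
    finally show ?thesis .
  next
    case False
    then show ?thesis using LR_mult_outside[OF a e False] LR_carrier_outside[OF a False] by simp
  qed
qed

lemma xdelta_top_mult:
  assumes x: "x \<in> E" and top: "\<And>y. y \<in> E \<Longrightarrow> leq m y x" and a: "a \<in> L"
  shows "mult (xdelta S m \<one> x) a = a"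
proof (intro ext)
  fix u \<eta>
  have "x \<in> \<eta>" if "a u \<eta> \<noteq> 0"
  proof -
    have f: "is_filter E m \<eta>" using LR_carrier_supp[OF a that] Dg_tight tight_filter by blast
    obtain y where y: "y \<in> \<eta>" using filter_nonempty[OF f] by blast
    then show ?thesis using filter_up[OF f y x] top filter_subset[OF f] by blast
  qed
  then show "mult (xdelta S m \<one> x) a u \<eta> = a u \<eta>" unfolding xdelta_mult[OF x a] by auto
qed

end

section \<open>Adjoining an identity\<close>

lemma mstar_None_right [simp]: "mstar m y None = y"
  by (cases y) auto

lemma leq_mstar [simp]:
  "leq (mstar m) (Some x) (Some y) \<longleftrightarrow> leq m x y"
  "leq (mstar m) w None"
  "\<not> leq (mstar m) None (Some y)"
  by (auto simp: leq_def)

lemma Sstar_simps [simp]: "Some x \<in> Sstar S \<longleftrightarrow> x \<in> S" "None \<in> Sstar S"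
  by (auto simp: Sstar_def)

context inv_sg
begin

lemma inv_semigroup0_Sstar: "inv_semigroup0 (Sstar S) (mstar m) (Some z)"
  unfolding inv_semigroup0_def
proof (intro conjI ballI)
  fix a assume a: "a \<in> Sstar S"
  show "mstar m (Some z) a = Some z" "mstar m a (Some z) = Some z"
    using a by (cases a; simp)+
  show "\<exists>!b. b \<in> Sstar S \<and> mstar m (mstar m a b) a = a \<and> mstar m (mstar m b a) b = b"
  proof (cases a)
    case None
    then show ?thesis by (intro ex1I[of _ None]) auto
  next
    case (Some x)
    then have x: "x \<in> S" using a by simp
    show ?thesis
    proof (rule ex1I[of _ "Some (st x)"])
      fix b assume b: "b \<in> Sstar S \<and> mstar m (mstar m a b) a = a \<and> mstar m (mstar m b a) b = b"
      \<comment> \<open>The case \<open>b = None\<close> is excluded since \<open>b a b = b\<close>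
        would read \<open>Some x = None\<close>.\<close>
      then show "b = Some (st x)" using Some x star_unique[OF x] by (cases b) auto
    qed (use Some x star_inner star_outer in auto)
  qed
  fix b assume b: "b \<in> Sstar S"
  show "mstar m a b \<in> Sstar S" using a b by (cases a; cases b; simp)
  fix c assume c: "c \<in> Sstar S"
  show "mstar m (mstar m a b) c = mstar m a (mstar m b c)"
    using a b c by (cases a; cases b; cases c; simp add: assoc)
qed simp

lemma idem_Sstar: "idem (Sstar S) (mstar m) = insert None (Some ` E)"
  by (auto simp: idem_def Sstar_def)

text \<open>The new idempotent \<open>None\<close> is not below any \<open>Some x\<close>, so the
  elements to be met by a cover are the same in both semilattices.\<close>

lemma preserves_finite_covers_Sstar:
  "preserves_finite_covers E m z (idem (Sstar S) (mstar m)) (mstar m) (Some z) Some"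
  unfolding preserves_finite_covers_def finite_cover_def idem_Sstar by auto

end

lemma (in graded) pure_grading_Sstar: "pure_grading (Sstar S) (mstar m) (Some z) G (phistar G \<phi>)"
  unfolding pure_grading_def idem_Sstar
proof (intro conjI ballI impI)
  show "phistar G \<phi> s \<in> carrier G" if "s \<in> Sstar S - {Some z}" for s
    using that by (cases s) (auto simp: phistar_def)
  show "phistar G \<phi> (mstar m a b) = phistar G \<phi> a \<otimes> phistar G \<phi> b"
    if "a \<in> Sstar S - {Some z}" "b \<in> Sstar S - {Some z}" "mstar m a b \<noteq> Some z" for a b
    using that by (cases a; cases b) (auto simp: phistar_def phi_mult)
  have "s \<in> Sstar S - {Some z} \<and> phistar G \<phi> s = \<one> \<longleftrightarrow> s \<in> insert None (Some ` E) - {Some z}" for s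
    by (cases s) (auto simp: phistar_def phi_one_iff idemD)
  then show "{s \<in> Sstar S - {Some z}. phistar G \<phi> s = \<one>} = insert None (Some ` E) - {Some z}"
    by blast
qed

section \<open>Sets with the new identity adjoined and extension by zero\<close>

text \<open>The filters of \<open>E\<^sup>*\<close> are the sets \<open>insert None (Some ` F)\<close> where \<open>F\<close> is a filter of \<open>E\<close>
  or empty.\<close>
definition adjoin :: "'a set \<Rightarrow> 'a option set" where
  "adjoin F = insert None (Some ` F)"

lemma adjoin_simps [simp]:
  "None \<in> adjoin F" "Some x \<in> adjoin F \<longleftrightarrow> x \<in> F" "Some -` adjoin F = F"
  by (auto simp: adjoin_def)

lemma adjoin_vimage: "None \<in> \<eta> \<Longrightarrow> adjoin (Some -` \<eta>) = \<eta>"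
proof -
  assume "None \<in> \<eta>"
  then have "x \<in> adjoin (Some -` \<eta>) \<longleftrightarrow> x \<in> \<eta>" for x by (cases x) auto
  then show ?thesis by blast
qed

lemma adjoin_cases:
  assumes "None \<in> \<eta>"
  obtains F where "\<eta> = adjoin F"
  using adjoin_vimage[OF assms] by metis

lemma adjoin_subset_iff [simp]: "adjoin F \<subseteq> adjoin F' \<longleftrightarrow> F \<subseteq> F'"
  by (auto simp: adjoin_def)

lemma adjoin_eq_iff [simp]: "adjoin F = adjoin F' \<longleftrightarrow> F = F'"
  by (metis adjoin_simps(3))

lemma Some_image_Int_adjoin [simp]: "Some ` Y \<inter> adjoin F = {} \<longleftrightarrow> Y \<inter> F = {}"
  by (auto simp: adjoin_def)

lemma Int_adjoin_empty_iff: "Y \<inter> adjoin F = {} \<longleftrightarrow> None \<notin> Y \<and> Some -` Y \<inter> F = {}"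
  by (auto simp: adjoin_def)

lemma finite_vimage_Some: "finite Y \<Longrightarrow> finite (Some -` Y)"
  by (simp add: finite_vimageI)

text \<open>At the extra point \<open>adjoin {}\<close> the value is \<open>a t {}\<close>. This is
  zero for \<open>a\<close> in the carrier, as the empty set is not a filter, so the map is
  extension by zero.\<close>

definition embed :: "('g \<Rightarrow> 'a set \<Rightarrow> 'r::comm_ring_1) \<Rightarrow> 'g \<Rightarrow> 'a option set \<Rightarrow> 'r" where
  "embed a = (\<lambda>t \<eta>. if None \<in> \<eta> then a t (Some -` \<eta>) else 0)"

lemma embed_adjoin [simp]: "embed a t (adjoin F) = a t F"
  by (simp add: embed_def)

lemma embed_eqI:
  assumes "\<And>F. b (adjoin F) = a t F" "\<And>\<eta>. None \<notin> \<eta> \<Longrightarrow> b \<eta> = 0"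
  shows "embed a t = b"
proof
  fix \<eta> show "embed a t \<eta> = b \<eta>"
    using assms adjoin_vimage[of \<eta>] by (metis embed_def)
qed

lemma inj_embed:
  fixes A :: "('g \<Rightarrow> 'a set \<Rightarrow> 'r::comm_ring_1) set"
  shows "inj_on embed A"
proof (rule inj_onI)
  fix a b :: "'g \<Rightarrow> 'a set \<Rightarrow> 'r::comm_ring_1" assume "embed a = embed b"
  then have "a t F = b t F" for t F by (metis embed_adjoin)
  then show "a = b" by blast
qed

lemma embed_add: "embed (a + b) = embed a + embed b"
  and embed_smult: "embed (LR_smult r a) = LR_smult r (embed a)"
  by (auto simp: embed_def LR_smult_def fun_eq_iff)

lemma embed_zero_iff [simp]: "embed a t = 0 \<longleftrightarrow> a t = 0"
proof
  assume "embed a t = 0"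
  then have "a t F = 0" for F by (metis embed_adjoin zero_fun_apply)
  then show "a t = 0" by (simp add: fun_eq_iff)
qed (auto simp: embed_def fun_eq_iff)

locale adjoin_one = graded S m z G \<phi>
  for S :: "'a set" and m :: "'a \<Rightarrow> 'a \<Rightarrow> 'a" (infixl "\<cdot>" 70) and z :: 'a
    and G :: "('g, 'b) monoid_scheme" (structure) and \<phi> :: "'a \<Rightarrow> 'g" +
  assumes nontrivial: "S \<noteq> {z}"
begin

sublocale adj: graded "Sstar S" "mstar m" "Some z" G "phistar G \<phi>"
proof
  show "inv_semigroup0 (Sstar S) (mstar m) (Some z)" by (rule inv_semigroup0_Sstar)
  show "pure_grading (Sstar S) (mstar m) (Some z) G (phistar G \<phi>)" by (rule pure_grading_Sstar)
qed

lemma E_adj: "adj.E = adjoin E"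
  by (simp add: idem_Sstar adjoin_def)

lemma star_Some: "s \<in> S \<Longrightarrow> adj.st (Some s) = Some (st s)"
  by (rule adj.star_unique) (auto simp: star_inner star_outer)

section \<open>Filters, ultrafilters and tight filters of the enlarged semilattice\<close>

lemma filter_adj_None:
  assumes "is_filter adj.E (mstar m) \<eta>"
  shows "None \<in> \<eta>"
proof -
  obtain x where x: "x \<in> \<eta>" using adj.filter_nonempty[OF assms] by blast
  show ?thesis by (rule adj.filter_up[OF assms x]) (simp_all add: E_adj)
qed

lemma filter_adjoin_iff:
  "is_filter adj.E (mstar m) (adjoin F) \<longleftrightarrow> F = {} \<or> is_filter E m F" (is "?L \<longleftrightarrow> ?R")
proof
  assume L: ?L
  show ?R
  proof (cases "F = {}")
    case False
    have "is_filter E m F"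
    proof (rule filterI)
      show "F \<subseteq> E" using adj.filter_subset[OF L] by (simp add: E_adj)
      show "z \<notin> F" using adj.filter_zero[OF L] by simp
      show "y \<in> F" if "x \<in> F" "y \<in> E" "leq m x y" for x y
        using adj.filter_up[OF L, of "Some x" "Some y"] that by (simp add: E_adj)
      show "x \<cdot> y \<in> F" if "x \<in> F" "y \<in> F" for x y
        using adj.filter_meet[OF L, of "Some x" "Some y"] that by simp
    qed (rule False)
    then show ?thesis by simp
  qed simp
next
  assume R: ?R
  show ?L
  proof (rule adj.filterI)
    show "adjoin F \<subseteq> adj.E" "Some z \<notin> adjoin F" "adjoin F \<noteq> {}"
      using R filter_subset filter_zero by (auto simp: E_adj adjoin_def)
    show "y \<in> adjoin F" if xy: "x \<in> adjoin F" "y \<in> adj.E" "leq (mstar m) x y" for x y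
    proof (cases y)
      case (Some y')
      then obtain x' where x': "x = Some x'" using xy(3) by (cases x) auto
      then have f: "is_filter E m F" using R xy(1) by auto
      show ?thesis using filter_up[OF f, of x' y'] xy x' Some by (simp add: E_adj)
    qed simp
    show "mstar m x y \<in> adjoin F" if mem: "x \<in> adjoin F" "y \<in> adjoin F" for x y
    proof (cases "x = None \<or> y = None")
      case False
      then obtain x' y' where xy: "x = Some x'" "y = Some y'" by auto
      then have f: "is_filter E m F" using R mem(1) by auto
      show ?thesis using filter_meet[OF f] mem xy by simp
    qed (use mem in auto)
  qed
qed

text \<open>Nontriviality enters here; for \<open>S = {z}\<close> the filter
  \<open>adjoin {}\<close> would be an ultrafilter.\<close>

lemma nonzero_idem:
  obtains e where "e \<in> E" "e \<noteq> z"
proof -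
  obtain s where "s \<in> S" "s \<noteq> z" using nontrivial zS by blast
  then show ?thesis using that[of "s \<cdot> st s"] star_mult_eq_zero_iff by simp
qed

lemma ultrafilter_adjoin_iff: "adjoin F \<in> ultrafilters adj.E (mstar m) \<longleftrightarrow> F \<in> ultrafilters E m"
  (is "?L \<longleftrightarrow> ?R")
proof
  assume L: ?L
  have max: "F' = F" if "is_filter E m F'" "F \<subseteq> F'" for F'
  proof -
    have "is_filter adj.E (mstar m) (adjoin F')" using that filter_adjoin_iff by simp
    then have "adjoin F' = adjoin F" using L that(2) by (simp only: ultrafilters_def mem_Collect_eq adjoin_subset_iff)
    then show ?thesis by simp
  qed
  obtain e where e: "e \<in> E" "e \<noteq> z" by (rule nonzero_idem)
  \<comment> \<open>If \<open>F\<close> were empty, maximality would make the principal filter of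
    \<open>e\<close> empty.\<close>
  have "F \<noteq> {}"
    using max[OF filter_principal[OF e]] filter_nonempty[OF filter_principal[OF e]] by blast
  then have "is_filter E m F" using L filter_adjoin_iff by (simp add: ultrafilters_def)
  then show ?R using max by (auto simp: ultrafilters_def)
next
  assume R: ?R
  then have f: "is_filter E m F" by (simp add: ultrafilters_def)
  have "\<eta> = adjoin F" if \<eta>: "is_filter adj.E (mstar m) \<eta>" "adjoin F \<subseteq> \<eta>" for \<eta>
  proof -
    obtain F' where F': "\<eta> = adjoin F'" using adjoin_cases[OF filter_adj_None[OF \<eta>(1)]] .
    then have sub: "F \<subseteq> F'" using \<eta>(2) by simp
    then have "is_filter E m F'" using \<eta>(1) F' filter_adjoin_iff filter_nonempty[OF f] by auto
    then show ?thesis using R sub F' by (simp add: ultrafilters_def)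
  qed
  then show ?L using f filter_adjoin_iff by (simp add: ultrafilters_def)
qed

lemma tight_adj_None: "\<eta> \<in> adj.T \<Longrightarrow> None \<in> \<eta>"
  by (rule filter_adj_None[OF adj.tight_filter])

text \<open>Ultrafilters correspond under \<open>adjoin\<close>, and so do basic conditions on
  nonempty filters, since \<open>None\<close> belongs to all filters and never to an excluded
  set.\<close>

lemma tight_adjoin_iff:
  assumes "F \<noteq> {}"
  shows "adjoin F \<in> adj.T \<longleftrightarrow> F \<in> T" (is "?L \<longleftrightarrow> ?R")
proof
  assume L: ?L
  have f: "is_filter E m F" using adj.tight_filter[OF L] filter_adjoin_iff assms by simp
  show ?R
    unfolding tight_iff
  proof (intro conjI ballI allI impI f)
    fix x Y assume x: "x \<in> F" and Y: "finite Y \<and> Y \<subseteq> E \<and> Y \<inter> F = {}"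
    have "Some ` Y \<subseteq> adj.E" using Y by (auto simp: E_adj)
    then obtain U where U: "U \<in> ultrafilters adj.E (mstar m)" "Some x \<in> U" "Some ` Y \<inter> U = {}"
      using adj.tightE[OF L, of "Some x" "Some ` Y"] x Y by auto
    then have "is_filter adj.E (mstar m) U" by (simp add: ultrafilters_def)
    then obtain V where "U = adjoin V" using adjoin_cases[OF filter_adj_None] by blast
    then show "\<exists>U\<in>ultrafilters E m. x \<in> U \<and> Y \<inter> U = {}"
      using U ultrafilter_adjoin_iff by (intro bexI[of _ V]) auto
  qed
next
  assume R: ?R
  show ?L
    unfolding adj.tight_iff
  proof (intro conjI ballI allI impI)
    show "is_filter adj.E (mstar m) (adjoin F)" using tight_filter[OF R] filter_adjoin_iff by simp
    fix x Y assume x: "x \<in> adjoin F" and Y: "finite Y \<and> Y \<subseteq> adj.E \<and> Y \<inter> adjoin F = {}"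
    \<comment> \<open>The condition given by \<open>None\<close> holds for every filter, so a
      stronger one coming from some member of the nonempty \<open>F\<close> may replace it.\<close>
    obtain x' where x': "x' \<in> F" "x = None \<or> x = Some x'"
      using x assms by (cases x) auto
    have Y': "finite (Some -` Y)" "Some -` Y \<subseteq> E" "Some -` Y \<inter> F = {}" "None \<notin> Y"
      using Y finite_vimage_Some by (auto simp: E_adj Int_adjoin_empty_iff)
    obtain U where U: "U \<in> ultrafilters E m" "x' \<in> U" "Some -` Y \<inter> U = {}"
      using tightE[OF R x'(1) Y'(1-3)] .
    show "\<exists>U\<in>ultrafilters adj.E (mstar m). x \<in> U \<and> Y \<inter> U = {}"
      using U x'(2) Y'(4) ultrafilter_adjoin_iff
      by (intro bexI[of _ "adjoin U"]) (auto simp: Int_adjoin_empty_iff)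
  qed
qed

lemma empty_not_tight: "{} \<notin> T"
  using filter_nonempty[OF tight_filter] by blast

lemma tight_imp_adjoin: "F \<in> T \<Longrightarrow> adjoin F \<in> adj.T"
  using tight_adjoin_iff[of F] empty_not_tight by auto

lemma tight_adj_cases:
  assumes "\<eta> \<in> adj.T"
  obtains "\<eta> = adjoin {}" | F where "F \<in> T" "\<eta> = adjoin F"
proof -
  obtain F where F: "\<eta> = adjoin F" using adjoin_cases[OF tight_adj_None[OF assms]] .
  then show ?thesis using that assms tight_adjoin_iff by metis
qed

section \<open>Comparison of the two partial actions\<close>

lemma Dg_imp_adjoin:
  assumes "F \<in> D g"
  shows "adjoin F \<in> adj.D g"
proof -
  obtain s where s: "s \<in> S" "s \<noteq> z" "\<phi> s = g" "s \<cdot> st s \<in> F" using assms unfolding Dg_iff by auto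
  then show ?thesis
    unfolding adj.Dg_iff using tight_imp_adjoin[OF Dg_tight[OF assms]] star_Some
    by (intro conjI bexI[of _ "Some s"]) (auto simp: phistar_def)
qed

text \<open>A witness other than some \<open>Some t\<close> can only be \<open>None\<close>, which
  has degree \<open>\<one>\<close>, and \<open>D \<one>\<close> contains all tight filters.\<close>

lemma adjoin_Dg_imp:
  assumes "adjoin F \<in> adj.D g" "F \<noteq> {}"
  shows "F \<in> D g"
proof -
  have F: "F \<in> T" using adj.Dg_tight[OF assms(1)] tight_adjoin_iff[OF assms(2)] by simp
  obtain s where s: "s \<in> Sstar S - {Some z}" "phistar G \<phi> s = g" "mstar m s (adj.st s) \<in> adjoin F"
    using assms(1) unfolding adj.Dg_iff by blast
  show ?thesis
  proof (cases s)
    case None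
    then have "g = \<one>" using s by (simp add: phistar_def)
    then show ?thesis using F Dg_one by simp
  next
    case (Some t)
    then have "t \<in> S - {z}" "\<phi> t = g" "t \<cdot> st t \<in> F" using s star_Some[of t] by (auto simp: phistar_def)
    then show ?thesis unfolding Dg_iff using F by blast
  qed
qed

text \<open>The only member of \<open>adjoin {}\<close> is \<open>None\<close>, and only
  \<open>None\<close> has it as range idempotent.\<close>

lemma adjoin_empty_Dg: "adjoin {} \<in> adj.D g \<Longrightarrow> g = \<one>"
proof -
  assume "adjoin {} \<in> adj.D g"
  then obtain s where s: "s \<in> Sstar S - {Some z}" "phistar G \<phi> s = g" "mstar m s (adj.st s) \<in> adjoin {}"
    unfolding adj.Dg_iff by blast
  then show "g = \<one>" using star_Some by (cases s) (auto simp: phistar_def)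
qed

text \<open>If \<open>s\<close> transports \<open>F\<close>, then \<open>Some s\<close> transports
  \<open>adjoin F\<close> by the same conjugation. The element \<open>None\<close> is conjugated to
  \<open>Some (st s \<cdot> s)\<close>, which belongs to \<open>adjoin F\<close>.\<close>

lemma theta_adjoin:
  assumes g: "g \<in> carrier G" and F: "F \<in> D (inv g)"
  shows "adj.\<theta> g (adjoin F) = adjoin (\<theta> g F)"
proof -
  obtain s where s: "s \<in> S" "s \<noteq> z" "\<phi> s = g" "st s \<cdot> s \<in> F" using Dg_invE[OF assms] .
  have FT: "F \<in> T" using Dg_tight[OF F] .
  have "adj.\<theta> g (adjoin F) = adj.transport (Some s) (adjoin F)"
    by (rule adj.theta_eq_transport[OF adj.tight_filter[OF tight_imp_adjoin[OF FT]]])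
      (use s star_Some in \<open>auto simp: phistar_def\<close>)
  also have "\<dots> = adjoin (transport s F)"
  proof -
    have "y \<in> adj.transport (Some s) (adjoin F) \<longleftrightarrow> y \<in> adjoin (transport s F)" for y
      using s star_Some by (cases y) (auto simp: adj.transport_def transport_def E_adj)
    then show ?thesis by blast
  qed
  also have "transport s F = \<theta> g F" using theta_eq_transport[OF tight_filter[OF FT] s] by simp
  finally show ?thesis .
qed

section \<open>The embedding is a homomorphism; its image\<close>

lemma embed_carrier:
  assumes a: "a \<in> L"
  shows "embed a \<in> adj.L"
proof -
  have "lc (Sstar S) (mstar m) (adj.D t) (embed a t)" for t
  proof -
    note lct = LR_carrierD(3)[OF a, of t]
    obtain Y where Y: "finite Y" "Y \<subseteq> E" "\<And>\<xi>. a t \<xi> \<noteq> 0 \<Longrightarrow> Y \<inter> \<xi> \<noteq> {}"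
      using lct by (rule lc_finite_cover) blast
    have nz: "\<exists>F. \<eta> = adjoin F \<and> a t F \<noteq> 0" if "embed a t \<eta> \<noteq> 0" for \<eta>
      using that adjoin_vimage[of \<eta>] by (metis embed_def)
    have a0: "a t {} = 0" using lc_supp[OF lct] empty_not_tight by blast
    show ?thesis
    proof (rule adj.lcI[where Y = "Some ` Y"])
      fix \<eta> assume "embed a t \<eta> \<noteq> 0"
      then obtain F where F: "\<eta> = adjoin F" "a t F \<noteq> 0" using nz by blast
      show "\<eta> \<in> adj.T \<and> \<eta> \<in> adj.D t"
        using lc_supp[OF lct F(2)] F(1) tight_imp_adjoin Dg_imp_adjoin by simp
      show "Some ` Y \<inter> \<eta> \<noteq> {}" using Y(3)[OF F(2)] F(1) by simp
    next
      show "finite (Some ` Y)" "Some ` Y \<subseteq> adj.E" using Y by (auto simp: E_adj)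
      show "adj.locconst (embed a t)"
        unfolding adj.locconst_def
      proof
        fix \<eta> assume "\<eta> \<in> adj.T"
        then show "\<exists>x\<in>\<eta>. \<exists>Y. finite Y \<and> Y \<subseteq> adj.E \<and> Y \<inter> \<eta> = {} \<and>
            (\<forall>\<eta>'\<in>adj.T. x \<in> \<eta>' \<and> Y \<inter> \<eta>' = {} \<longrightarrow> embed a t \<eta>' = embed a t \<eta>)"
        proof (cases rule: tight_adj_cases)
          \<comment> \<open>Near the extra point the finite set \<open>Y\<close> covering the
            support is used: a filter avoiding it lies outside the support.\<close>
          case 1
          show ?thesis
          proof (intro bexI[of _ None] exI[of _ "Some ` Y"] conjI ballI impI)
            fix \<eta>' assume "\<eta>' \<in> adj.T" and *: "None \<in> \<eta>' \<and> Some ` Y \<inter> \<eta>' = {}"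
            then obtain F' where "\<eta>' = adjoin F'" using adjoin_cases by blast
            then show "embed a t \<eta>' = embed a t \<eta>" using * Y(3)[of F'] a0 1 by auto
          qed (use 1 Y in \<open>auto simp: E_adj\<close>)
        next
          case (2 F)
          obtain x X where x: "x \<in> F" "finite X" "X \<subseteq> E" "X \<inter> F = {}"
            "\<And>F'. \<lbrakk>F' \<in> T; x \<in> F'; X \<inter> F' = {}\<rbrakk> \<Longrightarrow> a t F' = a t F"
            using locconstE[OF lc_locconst[OF lct] 2(1)] by metis
          show ?thesis
          proof (intro bexI[of _ "Some x"] exI[of _ "Some ` X"] conjI ballI impI)
            fix \<eta>' assume \<eta>': "\<eta>' \<in> adj.T" and *: "Some x \<in> \<eta>' \<and> Some ` X \<inter> \<eta>' = {}"
            then obtain F' where "F' \<in> T" "\<eta>' = adjoin F'" by (cases rule: tight_adj_cases) auto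
            then show "embed a t \<eta>' = embed a t \<eta>" using * x(5)[of F'] 2 by simp
          qed (use 2 x in \<open>auto simp: E_adj\<close>)
        qed
      qed
    qed
  qed
  moreover have "finite {t. embed a t \<noteq> 0}" using LR_carrierD(2)[OF a] by simp
  ultimately show ?thesis
    using LR_carrier_outside[OF a] by (simp add: LR_carrier_def)
qed

text \<open>In the formula of \<open>LR_mult_apply\<close> only indices with
  \<open>a s F \<noteq> 0\<close> matter, and for these \<open>F\<close> lies in the domain where
  \<open>theta_adjoin\<close> applies.\<close>

lemma embed_mult:
  assumes a: "a \<in> L" and b: "b \<in> L"
  shows "embed (mult a b) = adj.mult (embed a) (embed b)"
proof (rule ext)
  fix u
  note ea = embed_carrier[OF a] and eb = embed_carrier[OF b]
  show "embed (mult a b) u = adj.mult (embed a) (embed b) u"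
  proof (cases "u \<in> carrier G")
    case u: True
    let ?A = "{s. a s \<noteq> 0}"
    have A: "finite ?A" "{s. embed a s \<noteq> 0} \<subseteq> ?A" using LR_carrierD(2)[OF a] by auto
    note m' = adj.LR_mult_apply[OF ea eb u A]
    show ?thesis
    proof (rule embed_eqI)
      fix F
      have "embed a s (adjoin F) * embed b (inv s \<otimes> u) (adj.\<theta> (inv s) (adjoin F))
          = a s F * b (inv s \<otimes> u) (\<theta> (inv s) F)" for s
      proof (cases "a s F = 0")
        case False
        then have "a s \<noteq> 0" by auto
        then have s: "s \<in> carrier G" using LR_carrierD(1)[OF a] by blast
        then have "F \<in> D (inv (inv s))" using LR_carrier_supp[OF a False] by simp
        then show ?thesis using theta_adjoin[of "inv s" F] s by simp
      qed simp
      then show "adj.mult (embed a) (embed b) u (adjoin F) = mult a b u F"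
        unfolding m' LR_mult_apply[OF a b u A(1) subset_refl] by simp
    next
      fix \<eta> :: "'a option set" assume "None \<notin> \<eta>"
      then show "adj.mult (embed a) (embed b) u \<eta> = 0" unfolding m' by (simp add: embed_def)
    qed
  next
    case False
    then show ?thesis using LR_mult_outside[OF a b False] adj.LR_mult_outside[OF ea eb False] by simp
  qed
qed

lemma embed_xdelta: "embed (xdelta S m g x) = xdelta (Sstar S) (mstar m) g (Some x)"
proof (intro ext)
  fix t \<eta>
  have "None \<in> \<eta> \<and> Some -` \<eta> \<in> Vset E m x \<longleftrightarrow> \<eta> \<in> Vset adj.E (mstar m) (Some x)"
  proof (cases "None \<in> \<eta>")
    case True
    then obtain F where "\<eta> = adjoin F" using adjoin_cases by blast
    then show ?thesis using tight_adjoin_iff[of F] by (cases "F = {}") (auto simp: Vset_def)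
  next
    case False
    then show ?thesis using tight_adj_None by (auto simp: Vset_def)
  qed
  then show "embed (xdelta S m g x) t \<eta> = xdelta (Sstar S) (mstar m) g (Some x) t \<eta>"
    by (auto simp: embed_def xdelta_def)
qed

text \<open>If the point \<open>{None}\<close> is tight, a locally constant function vanishing there has support
  covered by finitely many \<open>V\<^sub>y\<close> with \<open>y \<in> E\<close>; if it is not tight, finitely many
  \<open>V\<^sub>y\<close> cover all tight filters of \<open>E\<close>.\<close>
lemma image_embed: "embed ` L = {b \<in> adj.L. \<forall>t. b t (adjoin {}) = 0}"
proof (intro equalityI subsetI)
  fix b :: "'g \<Rightarrow> 'a option set \<Rightarrow> 'r::comm_ring_1" assume "b \<in> embed ` L"
  then obtain a where a: "a \<in> L" "b = embed a" by blast
  have "a t {} = 0" for t using LR_carrier_supp[OF a(1)] Dg_tight empty_not_tight by blast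
  then show "b \<in> {b \<in> adj.L. \<forall>t. b t (adjoin {}) = 0}" using a embed_carrier by simp
next
  fix b :: "'g \<Rightarrow> 'a option set \<Rightarrow> 'r::comm_ring_1" assume "b \<in> {b \<in> adj.L. \<forall>t. b t (adjoin {}) = 0}"
  then have b: "b \<in> adj.L" and b0: "\<And>t. b t (adjoin {}) = 0" by auto
  define a where "a = (\<lambda>t F. b t (adjoin F))"
  have "b t \<eta> = 0" if "None \<notin> \<eta>" for t \<eta>
    using adj.LR_carrier_supp[OF b] adj.Dg_tight tight_adj_None that by blast
  then have eq: "embed a t = b t" for t by (intro embed_eqI) (auto simp: a_def)
  have "lc S m (D t) (a t)" for t
  proof -
    note lct = adj.LR_carrierD(3)[OF b, of t]
    note lcst = adj.lc_locconst[OF lct]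
    have supp: "F \<in> T \<and> F \<in> D t" if "a t F \<noteq> 0" for F
    proof -
      have "F \<noteq> {}" using that b0 by (auto simp: a_def)
      then show ?thesis
        using adj.lc_supp[OF lct, of "adjoin F"] that tight_adjoin_iff adjoin_Dg_imp by (simp add: a_def)
    qed
    have "\<exists>Y. finite Y \<and> Y \<subseteq> adj.E \<and> None \<notin> Y \<and> (\<forall>\<eta>\<in>adj.T. Y \<inter> \<eta> = {} \<longrightarrow> b t \<eta> = 0)"
    proof (cases "adjoin {} \<in> adj.T")
      case True
      obtain x Y where Y: "x \<in> adjoin {}" "finite Y" "Y \<subseteq> adj.E" "Y \<inter> adjoin {} = {}"
        "\<And>\<eta>. \<lbrakk>\<eta> \<in> adj.T; x \<in> \<eta>; Y \<inter> \<eta> = {}\<rbrakk> \<Longrightarrow> b t \<eta> = b t (adjoin {})"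
        using adj.locconstE[OF lcst True] by metis
      have "x = None" using Y(1) by (simp add: adjoin_def)
      then show ?thesis using Y tight_adj_None b0 by (intro exI[of _ Y]) (auto simp: Int_adjoin_empty_iff)
    next
      case False
      moreover have "is_filter adj.E (mstar m) (adjoin {})" by (simp add: filter_adjoin_iff)
      ultimately obtain x Y where Y: "x \<in> adjoin {}" "finite Y" "Y \<subseteq> adj.E" "Y \<inter> adjoin {} = {}"
        and none: "\<not> (\<exists>U\<in>ultrafilters adj.E (mstar m). x \<in> U \<and> Y \<inter> U = {})"
        unfolding adj.tight_iff by blast
      have x: "x = None" using Y(1) by (simp add: adjoin_def)
      \<comment> \<open>A tight filter avoiding \<open>Y\<close> would yield an ultrafilter avoiding
        \<open>Y\<close>, contrary to \<open>none\<close>.\<close>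
      have "Y \<inter> \<eta> \<noteq> {}" if "\<eta> \<in> adj.T" for \<eta>
        using adj.tightE[OF that tight_adj_None[OF that] Y(2,3)] none x by metis
      then show ?thesis using Y by (intro exI[of _ Y]) (auto simp: Int_adjoin_empty_iff)
    qed
    then obtain Y where Y: "finite Y" "Y \<subseteq> adj.E" "None \<notin> Y" "\<And>\<eta>. \<lbrakk>\<eta> \<in> adj.T; Y \<inter> \<eta> = {}\<rbrakk> \<Longrightarrow> b t \<eta> = 0"
      by blast
    show ?thesis
    proof (rule lcI[OF supp])
      show "finite (Some -` Y)" "Some -` Y \<subseteq> E" using Y finite_vimage_Some by (auto simp: E_adj)
      show "Some -` Y \<inter> F \<noteq> {}" if "a t F \<noteq> 0" for F
        using that supp[OF that] tight_imp_adjoin[of F] Y(3) Y(4)[of "adjoin F"]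
        by (auto simp: a_def Int_adjoin_empty_iff)
      show "locconst (a t)"
        unfolding locconst_def
      proof
        fix F assume F: "F \<in> T"
        obtain x X where x: "x \<in> adjoin F" "finite X" "X \<subseteq> adj.E" "X \<inter> adjoin F = {}"
          "\<And>\<eta>. \<lbrakk>\<eta> \<in> adj.T; x \<in> \<eta>; X \<inter> \<eta> = {}\<rbrakk> \<Longrightarrow> b t \<eta> = b t (adjoin F)"
          using adj.locconstE[OF lcst tight_imp_adjoin[OF F]] by metis
        obtain x' where x': "x' \<in> F" "x = None \<or> x = Some x'"
          using x(1) filter_nonempty[OF tight_filter[OF F]] by (cases x) auto
        show "\<exists>x\<in>F. \<exists>Y. finite Y \<and> Y \<subseteq> E \<and> Y \<inter> F = {} \<and>
            (\<forall>F'\<in>T. x \<in> F' \<and> Y \<inter> F' = {} \<longrightarrow> a t F' = a t F)"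
        proof (intro bexI[of _ x'] exI[of _ "Some -` X"] conjI ballI impI)
          fix F' assume F': "F' \<in> T" "x' \<in> F' \<and> Some -` X \<inter> F' = {}"
          then show "a t F' = a t F"
            unfolding a_def using x'(2) x(4)
            by (intro x(5) tight_imp_adjoin) (auto simp: Int_adjoin_empty_iff)
        qed (use x x' finite_vimage_Some in \<open>auto simp: E_adj Int_adjoin_empty_iff\<close>)
      qed
    qed
  qed
  moreover have "a t = 0 \<longleftrightarrow> b t = 0" for t using eq[of t] embed_zero_iff[of a t] by simp
  ultimately have "a \<in> L" using b by (simp add: LR_carrier_def)
  moreover have "b = embed a" using eq by auto
  ultimately show "b \<in> embed ` L" by blast
qed

section \<open>The image as an essential ideal\<close>

text \<open>By \<open>image_embed\<close> only the value at \<open>adjoin {}\<close> is at stake. In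
  \<open>adj.mult x a\<close> a nonzero \<open>x s\<close> there forces \<open>s = \<one>\<close>,
  which fixes the point; in \<open>adj.mult a x\<close> the first factor already vanishes.\<close>

lemma image_embed_ideal:
  assumes x: "x \<in> adj.L" and a: "a \<in> embed ` L"
  shows "adj.mult x a \<in> embed ` L" and "adj.mult a x \<in> embed ` L"
proof -
  have aL: "a \<in> adj.L" and a0: "\<And>t. a t (adjoin {}) = 0" using a unfolding image_embed by auto
  have "adj.mult x a u (adjoin {}) = 0" for u
  proof (cases "u \<in> carrier G")
    case True
    have "x s (adjoin {}) * a (inv s \<otimes> u) (adj.\<theta> (inv s) (adjoin {})) = 0" for s
    proof (cases "x s (adjoin {}) = 0")
      case False
      then have "adjoin {} \<in> adj.D s" using adj.LR_carrier_supp[OF x] by blast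
      then have "s = \<one>" "is_filter adj.E (mstar m) (adjoin {})"
        using adjoin_empty_Dg adj.Dg_tight adj.tight_filter by blast+
      then show ?thesis using adj.theta_one a0 by simp
    qed simp
    then show ?thesis using adj.LR_mult_apply[OF x aL True adj.LR_carrierD(2)[OF x] subset_refl] by simp
  qed (simp add: adj.LR_mult_outside[OF x aL])
  then show "adj.mult x a \<in> embed ` L" unfolding image_embed using adj.LR_mult_closed[OF x aL] by blast
  have "adj.mult a x u (adjoin {}) = 0" for u
  proof (cases "u \<in> carrier G")
    case True
    then show ?thesis using adj.LR_mult_apply[OF aL x True adj.LR_carrierD(2)[OF aL] subset_refl] a0 by simp
  qed (simp add: adj.LR_mult_outside[OF aL x])
  then show "adj.mult a x \<in> embed ` L" unfolding image_embed using adj.LR_mult_closed[OF aL x] by blast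
qed

text \<open>Multiplying by the degree-one element of \<open>e \<in> F\<close> does not change the
  value at \<open>adjoin F\<close>, so \<open>x\<close> vanishes at all these points. The extra
  point is a limit of them.\<close>

lemma image_embed_essential:
  assumes x: "x \<in> adj.L" and ann: "\<And>a. a \<in> embed ` L \<Longrightarrow> adj.mult a x = 0"
  shows "x = 0"
proof -
  have x1: "x t (adjoin F) = 0" if F: "F \<in> T" for t F
  proof -
    obtain e where e: "e \<in> F" using filter_nonempty[OF tight_filter[OF F]] by blast
    have eE: "e \<in> E" using filter_subset[OF tight_filter[OF F]] e by blast
    then have Se: "Some e \<in> adj.E" by (simp add: E_adj)
    have "adj.mult (xdelta (Sstar S) (mstar m) \<one> (Some e)) x t (adjoin F) = 0"
      using ann[OF imageI[OF xdelta_one_carrier[OF eE]]] by (simp add: embed_xdelta)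
    then show ?thesis unfolding adj.xdelta_mult[OF Se x] using e by simp
  qed
  have x2: "x t (adjoin {}) = 0" for t
  proof (cases "adjoin {} \<in> adj.T")
    case True
    obtain y Y where Y: "y \<in> adjoin {}" "finite Y" "Y \<subseteq> adj.E" "Y \<inter> adjoin {} = {}"
      "\<And>\<eta>. \<lbrakk>\<eta> \<in> adj.T; y \<in> \<eta>; Y \<inter> \<eta> = {}\<rbrakk> \<Longrightarrow> x t \<eta> = x t (adjoin {})"
      using adj.locconstE[OF adj.lc_locconst[OF adj.LR_carrierD(3)[OF x]] True] by metis
    \<comment> \<open>If the extra point is tight, each neighbourhood contains an ultrafilter, which
      has the form \<open>adjoin F\<close> with \<open>F\<close> tight; local constancy then carries
      the zero over.\<close>
    obtain U where U: "U \<in> ultrafilters adj.E (mstar m)" "y \<in> U" "Y \<inter> U = {}"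
      using adj.tightE[OF True Y(1-4)] .
    then have UT: "U \<in> adj.T" using adj.ultrafilter_tight by blast
    then obtain F where F: "U = adjoin F" using adjoin_cases tight_adj_None by blast
    then have "F \<in> T" using U(1) ultrafilter_adjoin_iff ultrafilter_tight by blast
    then show ?thesis using Y(5)[OF UT U(2,3)] x1 F by simp
  next
    case False
    then show ?thesis using adj.LR_carrier_supp[OF x] adj.Dg_tight by blast
  qed
  have "x t \<eta> = 0" for t \<eta>
  proof (cases "\<eta> \<in> adj.T")
    case True
    then show ?thesis by (cases rule: tight_adj_cases) (simp_all add: x1 x2)
  next
    case False
    then show ?thesis using adj.LR_carrier_supp[OF x] adj.Dg_tight by blast
  qed
  then show ?thesis by (simp add: fun_eq_iff)
qed

section \<open>The unit, and when the embedding is onto\<close>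

text \<open>Every tight filter of the enlarged semilattice contains \<open>None\<close>, so this is
  the constant function 1 in degree \<open>\<one>\<close>.\<close>

abbreviation unit :: "'g \<Rightarrow> 'a option set \<Rightarrow> 'r::comm_ring_1" where
  "unit \<equiv> xdelta (Sstar S) (mstar m) \<one> None"

lemma unit_carrier: "unit \<in> adj.L"
  by (rule adj.xdelta_one_carrier) (simp add: E_adj)

lemma unit_mult: "x \<in> adj.L \<Longrightarrow> adj.mult unit x = x"
  and mult_unit: "x \<in> adj.L \<Longrightarrow> adj.mult x unit = x"
  by (rule adj.xdelta_top_mult adj.mult_xdelta_top; simp add: E_adj)+

lemma surj_embed_iff_unital:
  "embed ` L = (adj.L :: ('g \<Rightarrow> 'a option set \<Rightarrow> 'r::comm_ring_1) set)
    \<longleftrightarrow> LR_unital S m z G \<phi> TYPE('r)" (is "?L \<longleftrightarrow> ?R")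
proof
  assume L: ?L
  then obtain u :: "'g \<Rightarrow> 'a set \<Rightarrow> 'r" where u: "u \<in> L" "embed u = unit"
    using unit_carrier by (metis imageE)
  have "mult u x = x \<and> mult x u = x" if x: "x \<in> L" for x
    using embed_mult[OF u(1) x] embed_mult[OF x u(1)] u(2)
      unit_mult[OF embed_carrier[OF x]] mult_unit[OF embed_carrier[OF x]]
      \<comment> \<open>Both identities hold after applying \<open>embed\<close>, and injectivity
        brings them back.\<close>
      inj_onD[OF inj_embed[of UNIV]] by auto
  then show ?R unfolding LR_unital_def using u(1) by blast
next
  assume ?R
  then obtain u :: "'g \<Rightarrow> 'a set \<Rightarrow> 'r" where u: "u \<in> L"
    "\<And>x. x \<in> L \<Longrightarrow> mult u x = x \<and> mult x u = x"
    unfolding LR_unital_def by blast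
  note eu = embed_carrier[OF u(1)]
  \<comment> \<open>Multiplied on the left by an image \<open>embed x\<close>, the difference gives
    \<open>embed x\<close> minus \<open>embed (mult x u)\<close>, which is zero.\<close>
  have "unit - embed u = 0"
  proof (rule image_embed_essential)
    show "unit - embed u \<in> adj.L" using adj.LR_carrier_diff[OF unit_carrier eu] .
    fix a assume "a \<in> embed ` (L :: ('g \<Rightarrow> 'a set \<Rightarrow> 'r) set)"
    then obtain x where x: "x \<in> L" "a = embed x" by blast
    note ex = embed_carrier[OF x(1)]
    show "adj.mult a (unit - embed u) = 0"
      unfolding x(2) adj.LR_mult_diff_right[OF unit_carrier eu ex] mult_unit[OF ex]
        embed_mult[OF x(1) u(1), symmetric] using u(2)[OF x(1)] by simp
  qed
  then have unit: "unit \<in> embed ` (L :: ('g \<Rightarrow> 'a set \<Rightarrow> 'r) set)" using u(1) by simp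
  show ?L
  proof (intro equalityI subsetI)
    show "b \<in> adj.L" if "b \<in> embed ` L" for b :: "'g \<Rightarrow> 'a option set \<Rightarrow> 'r"
      using that embed_carrier by blast
    show "b \<in> embed ` L" if "b \<in> adj.L" for b :: "'g \<Rightarrow> 'a option set \<Rightarrow> 'r"
      using image_embed_ideal(1)[OF that unit] unfolding mult_unit[OF that] .
  qed
qed

end

theorem mainTheorem19:
  fixes S :: "'a set" and m :: "'a \<Rightarrow> 'a \<Rightarrow> 'a" and z :: 'a
    and G :: "('g, 'b) monoid_scheme" and \<phi> :: "'a \<Rightarrow> 'g"
  assumes "inv_semigroup0 S m z"
    and "S \<noteq> {z}"
    and "group G"
    and "pure_grading S m z G \<phi>"
  shows "inv_semigroup0 (Sstar S) (mstar m) (Some z)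
    \<and> pure_grading (Sstar S) (mstar m) (Some z) G (phistar G \<phi>)
    \<and> preserves_finite_covers (idem S m) m z (idem (Sstar S) (mstar m)) (mstar m) (Some z) Some
    \<and> LR_unital (Sstar S) (mstar m) (Some z) G (phistar G \<phi>) TYPE('r::comm_ring_1)
    \<and> (\<exists>\<iota> :: ('g \<Rightarrow> 'a set \<Rightarrow> 'r) \<Rightarrow> ('g \<Rightarrow> 'a option set \<Rightarrow> 'r).
         (\<forall>a\<in>LR_carrier S m z G \<phi>. \<iota> a \<in> LR_carrier (Sstar S) (mstar m) (Some z) G (phistar G \<phi>))
       \<and> inj_on \<iota> (LR_carrier S m z G \<phi>)
       \<and> (\<forall>a\<in>LR_carrier S m z G \<phi>. \<forall>b\<in>LR_carrier S m z G \<phi>.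
            \<iota> (a + b) = \<iota> a + \<iota> b
          \<and> \<iota> (LR_mult S m z G \<phi> a b)
              = LR_mult (Sstar S) (mstar m) (Some z) G (phistar G \<phi>) (\<iota> a) (\<iota> b))
       \<and> (\<forall>r. \<forall>a\<in>LR_carrier S m z G \<phi>. \<iota> (LR_smult r a) = LR_smult r (\<iota> a))
       \<and> (\<forall>g\<in>carrier G. \<forall>x\<in>Eg S m z \<phi> g.
            \<iota> (xdelta S m g x) = xdelta (Sstar S) (mstar m) g (Some x))
       \<and> (\<iota> ` LR_carrier S m z G \<phi> = LR_carrier (Sstar S) (mstar m) (Some z) G (phistar G \<phi>)
            \<longleftrightarrow> LR_unital S m z G \<phi> TYPE('r))
       \<and> (let I = \<iota> ` LR_carrier S m z G \<phi>;
              L = LR_carrier (Sstar S) (mstar m) (Some z) G (phistar G \<phi>);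
              M = LR_mult (Sstar S) (mstar m) (Some z) G (phistar G \<phi>)
          in 0 \<in> I \<and> (\<forall>a\<in>I. \<forall>b\<in>I. a + b \<in> I \<and> a - b \<in> I)
             \<and> (\<forall>r. \<forall>a\<in>I. LR_smult r a \<in> I)
             \<and> (\<forall>x\<in>L. \<forall>a\<in>I. M x a \<in> I \<and> M a x \<in> I)
             \<and> (\<forall>x\<in>L. (\<forall>a\<in>I. M x a = 0 \<and> M a x = 0) \<longrightarrow> x = 0)))"
proof -
  interpret group G by fact
  interpret adjoin_one S m z G \<phi>
    by unfold_locales (use assms in auto)
  have unital: "LR_unital (Sstar S) (mstar m) (Some z) G (phistar G \<phi>) TYPE('r)"
    unfolding LR_unital_def using unit_carrier unit_mult mult_unit by blast
  have zero: "0 \<in> embed ` (L :: ('g \<Rightarrow> 'a set \<Rightarrow> 'r) set)"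
    unfolding image_embed by (simp add: LR_carrier_def adj.lc_zero)
  have add: "a + b \<in> embed ` L" "a - b \<in> embed ` L"
    if "a \<in> embed ` L" "b \<in> embed ` L" for a b :: "'g \<Rightarrow> 'a option set \<Rightarrow> 'r"
    using that unfolding image_embed by (auto intro: adj.LR_carrier_add adj.LR_carrier_diff)
  have smult: "LR_smult r a \<in> embed ` L" if "a \<in> embed ` L" for r and a :: "'g \<Rightarrow> 'a option set \<Rightarrow> 'r"
    using that by (auto simp: embed_smult[symmetric] intro!: imageI LR_carrier_smult)
  show ?thesis
    unfolding Let_def
  proof (intro conjI exI[of _ embed])
    show "\<forall>x\<in>adj.L. (\<forall>a\<in>embed ` L. adj.mult x a = 0 \<and> adj.mult a x = 0) \<longrightarrow> x = (0 :: 'g \<Rightarrow> 'a option set \<Rightarrow> 'r)"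
    proof (intro ballI impI)
      fix x :: "'g \<Rightarrow> 'a option set \<Rightarrow> 'r"
      assume x: "x \<in> adj.L" and ann: "\<forall>a\<in>embed ` L. adj.mult x a = 0 \<and> adj.mult a x = 0"
      show "x = 0" by (rule image_embed_essential[OF x conjunct2[OF bspec[OF ann]]])
    qed
    show "embed ` L = (adj.L :: ('g \<Rightarrow> 'a option set \<Rightarrow> 'r) set) \<longleftrightarrow> LR_unital S m z G \<phi> TYPE('r)"
      by (rule surj_embed_iff_unital)
  qed (intro ballI allI conjI inv_semigroup0_Sstar pure_grading_Sstar preserves_finite_covers_Sstar
      unital embed_carrier inj_embed embed_add embed_mult embed_smult embed_xdelta zero add smult
      image_embed_ideal; assumption)+
qed

end
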